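(* Assume (a) $G_C=G$ does not depend on $C$; (b) $\mathbf X$ is finite and $\mathsf P_G(X_t=x)>0$ for all $x$; (c) $0<I(\theta,\vartheta\mid x)<\infty$ for all $\theta\ne\vartheta$ and all $x$; (d) $\Theta$ is finite; (e) (saddle point) for every configuration $(\theta_1,\theta_2)$ that is not implicitly revealing and has arm 2 preferred for every $x$, $$\inf_{\{\theta:\exists x_0,\ \mu_\theta(x_0)>\mu_{\theta_2}(x_0)\}}\sup_x I(\theta_1,\theta\mid x)=\sup_x\inf_{\{\theta:\exists x_0,\ \mu_\theta(x_0)>\mu_{\theta_2}(x_0)\}} I(\theta_1,\theta\mid x),$$ and symmetrically when arm 1 is preferred for every $x$. Then there exists an allocation rule $\{\phi_\tau\}$ such that: (1) for every implicitly revealing $C_0$, $\lim_{t\to\infty}\mathsf E_{C_0}\{T_{inf}(t)\}<\infty$; (2) for every $C_0=(\theta_1,\theta_2)$ that is not implicitly revealing (and has distinct arms), $\limsup_{t\to\infty}\mathsf E_{C_0}\{T_{inf}(t)\}/\log t\le 1/K_{C_0}$, where, if arm 2 is preferred for every $x$, $K_{C_0}=\inf_{\{\theta:\exists x_0,\ \mu_\theta(x_0)>\mu_{\theta_2}(x_0)\}}\sup_x I(\theta_1,\theta\mid x)$, and symmetrically if arm 1 is preferred.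
   Context: Two-armed bandit with side observations. $\Theta\subset\mathbb R$ is a parameter set and $\mathbf X\subset\mathbb R$. Known conditional distributions $\{F_\theta(dy\mid x)\}_{\theta\in\Theta}$ on $\mathbb R$ and a known law $G$ on $\mathbf X$. Under configuration $C_0=(\theta_1,\theta_2)\in\Theta^2$, $X_1,X_2,\dots$ are i.i.d. with law $G$, and for each arm $i$ the pairs $(X_t,Y^i_t)$ are i.i.d. with joint law $G(dx)F_{\theta_i}(dy\mid x)$. An allocation rule is $\phi_t\in\{1,2\}$ depending only on $X_1,\dots,X_t$ and previously observed rewards $Y^{\phi_\tau}_\tau$, $\tau<t$. $\mu_\theta(x)=\int yF_\theta(dy\mid x)$ (finite); $M_C(x)=\arg\max_i\mu_{i(C)}(x)$ with $1(C)=\theta_1,2(C)=\theta_2$. A configuration $C$ is implicitly revealing if there exist $x_1,x_2\in\mathbf X$ with $M_C(x_1)=1$ and $M_C(x_2)=2$; otherwise the preferred arm $M_C(x)$ is the same for all $x$. $T_{inf}(t)=\sum_{\tau\le t}1\{\phi_\tau\ne M_{C_0}(X_\tau)\}$. $I(\theta,\vartheta\mid x)$ is the Kullback–Leibler number between $F_\theta(\cdot\mid x)$ and $F_\vartheta(\cdot\mid x)$. Conventions: $\inf\emptyset=\infty$, $1/\infty=0$. *)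

theory Defs
  imports "HOL-Probability.Probability"
begin

text \<open>Conditional reward kernels: F :: real (parameter theta) => real (context x) => real measure.\<close>

definition mu :: "(real \<Rightarrow> real \<Rightarrow> real measure) \<Rightarrow> real \<Rightarrow> real \<Rightarrow> real" where
  "mu F th x = (\<integral>y. y \<partial>(F th x))"

definition KL :: "real measure \<Rightarrow> real measure \<Rightarrow> ereal" where
  "KL P Q = (if absolutely_continuous Q P \<and> integrable P (entropy_density (exp 1) Q P)
             then ereal (KL_divergence (exp 1) Q P) else \<infinity>)"

definition KLI :: "(real \<Rightarrow> real \<Rightarrow> real measure) \<Rightarrow> real \<Rightarrow> real \<Rightarrow> real \<Rightarrow> ereal" where
  "KLI F th vth x = KL (F th x) (F vth x)"

definition par :: "real \<times> real \<Rightarrow> nat \<Rightarrow> real" where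
  "par C i = (if i = 1 then fst C else snd C)"

definition pref :: "(real \<Rightarrow> real \<Rightarrow> real measure) \<Rightarrow> real \<times> real \<Rightarrow> real \<Rightarrow> nat set" where
  "pref F C x = {i \<in> {1, 2}. \<forall>j \<in> {1, 2}. mu F (par C j) x \<le> mu F (par C i) x}"

definition revealing :: "(real \<Rightarrow> real \<Rightarrow> real measure) \<Rightarrow> real set \<Rightarrow> real \<times> real \<Rightarrow> bool" where
  "revealing F Xs C \<longleftrightarrow> (\<exists>x1 \<in> Xs. \<exists>x2 \<in> Xs. 1 \<in> pref F C x1 \<and> 2 \<in> pref F C x2)"

definition Kinfsup :: "(real \<Rightarrow> real \<Rightarrow> real measure) \<Rightarrow> real set \<Rightarrow> real set \<Rightarrow> real \<Rightarrow> real \<Rightarrow> ereal" where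
  "Kinfsup F Th Xs bad good =
     (INF th \<in> {th \<in> Th. \<exists>x0 \<in> Xs. mu F th x0 > mu F good x0}. SUP x \<in> Xs. KLI F bad th x)"

definition Ksupinf :: "(real \<Rightarrow> real \<Rightarrow> real measure) \<Rightarrow> real set \<Rightarrow> real set \<Rightarrow> real \<Rightarrow> real \<Rightarrow> ereal" where
  "Ksupinf F Th Xs bad good =
     (SUP x \<in> Xs. INF th \<in> {th \<in> Th. \<exists>x0 \<in> Xs. mu F th x0 > mu F good x0}. KLI F bad th x)"

definition step :: "(real \<Rightarrow> real \<Rightarrow> real measure) \<Rightarrow> real pmf \<Rightarrow> real \<times> real
    \<Rightarrow> (real \<times> real \<times> real) measure" where
  "step F G C = measure_pmf G \<bind>
      (\<lambda>x. distr (F (fst C) x \<Otimes>\<^sub>M F (snd C) x) borel (\<lambda>(y1, y2). (x, y1, y2)))"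

definition Omega :: "(real \<Rightarrow> real \<Rightarrow> real measure) \<Rightarrow> real pmf \<Rightarrow> real \<times> real
    \<Rightarrow> (real \<times> real \<times> real) stream measure" where
  "Omega F G C = stream_space (step F G C)"

definition Xo :: "(real \<times> real \<times> real) stream \<Rightarrow> nat \<Rightarrow> real" where
  "Xo w t = fst (w !! t)"

definition Yo :: "nat \<Rightarrow> (real \<times> real \<times> real) stream \<Rightarrow> nat \<Rightarrow> real" where
  "Yo i w t = (if i = 1 then fst (snd (w !! t)) else snd (snd (w !! t)))"

text \<open>An allocation rule pi maps the observed history (X_tau, Y^{phi_tau}_tau), tau < t,
  and the current context X_t to an arm. hist is the observed history before time t.\<close>
fun hist :: "((real \<times> real) list \<Rightarrow> real \<Rightarrow> nat) \<Rightarrow> (real \<times> real \<times> real) stream \<Rightarrow> nat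
    \<Rightarrow> (real \<times> real) list" where
  "hist pol w 0 = []"
| "hist pol w (Suc t) = hist pol w t @ [(Xo w t, Yo (pol (hist pol w t) (Xo w t)) w t)]"

definition arm :: "((real \<times> real) list \<Rightarrow> real \<Rightarrow> nat) \<Rightarrow> (real \<times> real \<times> real) stream \<Rightarrow> nat \<Rightarrow> nat" where
  "arm pol w t = pol (hist pol w t) (Xo w t)"

definition Tinf :: "(real \<Rightarrow> real \<Rightarrow> real measure) \<Rightarrow> real \<times> real \<Rightarrow> ((real \<times> real) list \<Rightarrow> real \<Rightarrow> nat)
    \<Rightarrow> (real \<times> real \<times> real) stream \<Rightarrow> nat \<Rightarrow> nat" where
  "Tinf F C pol w t = card {tau. tau < t \<and> arm pol w tau \<notin> pref F C (Xo w tau)}"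

definition ETinf :: "(real \<Rightarrow> real \<Rightarrow> real measure) \<Rightarrow> real pmf \<Rightarrow> real \<times> real
    \<Rightarrow> ((real \<times> real) list \<Rightarrow> real \<Rightarrow> nat) \<Rightarrow> nat \<Rightarrow> real" where
  "ETinf F G C pol t = (\<integral>w. real (Tinf F C pol w t) \<partial>(Omega F G C))"

end

theory Submission
  imports Defs "HOL-Real_Asymp.Real_Asymp"
begin

text \<open>The rule computes the maximum likelihood estimate of each arm's parameter and calls an arm
  acceptable if it is optimal for the estimated configuration, or if that configuration is not
  implicitly revealing, the context is the one that best separates the inferior arm from the
  parameters that would make it optimal somewhere, and those parameters have not yet been rejected
  at level about \<open>1 / t\<close>. Among acceptable arms it pulls the less sampled one.

  For an additive statistic \<open>S\<close> of the observed data with one-step bound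
  \<open>E exp f \<le> 1\<close>, the process \<open>exp S\<close> is a supermartingale under any adaptive
  sampling, and if the bound is \<open>1 - \<delta>\<close> on pulls of a given arm, then the total expected
  weight \<open>exp S\<close> carried by those pulls is at most \<open>1 / \<delta>\<close>. Finiteness of the
  Kullback-Leibler numbers gives such bounds for small multiples of the log-likelihood ratio. Hence
  the expected number of pulls of an arm whose estimate is wrong is finite; an arm with at least half
  of the pulls has a wrong estimate only finitely often; and if the other arm has a wrong estimate
  and few pulls, then either it would be pulled in some context, which has positive probability, or
  its true parameter has been rejected, which has summable probability. What remains are the
  exploratory pulls at a correctly estimated configuration. These occur only if it is not revealing,
  and by the same weighting their number exceeds \<open>ln t / k\<close> by a bounded amount in expectation,
  for every \<open>k\<close> below the saddle value.\<close>

subsection \<open>Reward streams\<close>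

definition resample :: "'a stream \<Rightarrow> nat \<Rightarrow> 'a \<Rightarrow> 'a stream" where
  "resample w t s = stake t w @- s ## sdrop (Suc t) w"

lemma resample_0: "resample w 0 s = s ## stl w"
  by (simp add: resample_def)

lemma resample_Suc: "resample (x ## w) (Suc t) s = x ## resample w t s"
  by (simp add: resample_def)

lemma snth_resample: "resample w t s !! u = (if u = t then s else w !! u)"
proof (induction t arbitrary: w u)
  case 0
  then show ?case by (cases u) (auto simp: resample_0)
next
  case (Suc t)
  show ?case
    using Suc[of "stl w"] resample_Suc[of "shd w" "stl w" t s] by (cases u) auto
qed

lemma measurable_resample [measurable (raw)]:
  assumes [measurable]: "f \<in> N \<rightarrow>\<^sub>M stream_space M" "g \<in> N \<rightarrow>\<^sub>M M"
  shows "(\<lambda>z. resample (f z) t (g z)) \<in> N \<rightarrow>\<^sub>M stream_space M"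
  by (rule measurable_stream_space2) (simp add: snth_resample)

text \<open>Entries are independent, so replacing the \<open>t\<close>-th by a fresh draw preserves
  the law of the stream. This takes the place of conditioning on the past. The induction peels off
  the head; Fubini is needed only at entry \<open>0\<close>.\<close>

lemma (in prob_space) nn_integral_resample:
  assumes "f \<in> borel_measurable (stream_space M)"
  shows "(\<integral>\<^sup>+w. f w \<partial>stream_space M) = (\<integral>\<^sup>+w. \<integral>\<^sup>+s. f (resample w t s) \<partial>M \<partial>stream_space M)"
  using assms
proof (induction t arbitrary: f)
  case 0
  note [measurable] = 0
  interpret S: prob_space "stream_space M" by (rule prob_space_stream_space)
  interpret P: pair_sigma_finite M "stream_space M" by unfold_locales
  have "(\<integral>\<^sup>+w. \<integral>\<^sup>+s. f (resample w 0 s) \<partial>M \<partial>stream_space M)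
      = (\<integral>\<^sup>+x. \<integral>\<^sup>+w. \<integral>\<^sup>+s. f (s ## w) \<partial>M \<partial>stream_space M \<partial>M)"
    by (subst nn_integral_stream_space) (auto simp: resample_0)
  also have "\<dots> = (\<integral>\<^sup>+w. \<integral>\<^sup>+s. f (s ## w) \<partial>M \<partial>stream_space M)"
    by (simp add: emeasure_space_1)
  also have "\<dots> = (\<integral>\<^sup>+s. \<integral>\<^sup>+w. f (s ## w) \<partial>stream_space M \<partial>M)"
    by (rule P.Fubini') simp
  also have "\<dots> = (\<integral>\<^sup>+w. f w \<partial>stream_space M)"
    by (simp add: nn_integral_stream_space)
  finally show ?case by simp
next
  case (Suc t)
  note [measurable] = Suc.prems
  have "(\<integral>\<^sup>+w. \<integral>\<^sup>+s. f (resample w (Suc t) s) \<partial>M \<partial>stream_space M)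
     = (\<integral>\<^sup>+x. \<integral>\<^sup>+w. \<integral>\<^sup>+s. f (x ## resample w t s) \<partial>M \<partial>stream_space M \<partial>M)"
    by (subst nn_integral_stream_space) (auto simp: resample_Suc)
  also have "\<dots> = (\<integral>\<^sup>+x. \<integral>\<^sup>+w. f (x ## w) \<partial>stream_space M \<partial>M)"
    by (rule nn_integral_cong, rule Suc.IH[symmetric]) simp
  also have "\<dots> = (\<integral>\<^sup>+w. f w \<partial>stream_space M)"
    by (simp add: nn_integral_stream_space)
  finally show ?case by simp
qed

section \<open>The law of one round\<close>

locale bandit_env =
  fixes Xs :: "real set" and F :: "real \<Rightarrow> real \<Rightarrow> real measure" and G :: "real pmf"
    and C :: "real \<times> real"
  assumes F_prob: "\<And>i x. x \<in> Xs \<Longrightarrow> prob_space (F (par C i) x)"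
    and F_sets: "\<And>i x. x \<in> Xs \<Longrightarrow> sets (F (par C i) x) = sets borel"
    and G_supp: "set_pmf G \<subseteq> Xs" and fin_Xs: "finite Xs"
begin

definition ker :: "real \<Rightarrow> (real \<times> real \<times> real) measure" where
  "ker x = distr (F (fst C) x \<Otimes>\<^sub>M F (snd C) x) borel (\<lambda>(y1, y2). (x, y1, y2))"

lemma F_facts:
  assumes "x \<in> Xs"
  shows "prob_space (F (fst C) x)" "prob_space (F (snd C) x)"
    "sets (F (fst C) x) = sets borel" "sets (F (snd C) x) = sets borel"
  using F_prob[OF assms, of 1] F_prob[OF assms, of 2] F_sets[OF assms, of 1] F_sets[OF assms, of 2]
  by (auto simp: par_def)

lemma triple_measurable:
  assumes "x \<in> Xs"
  shows "(\<lambda>(y1, y2). (x, y1, y2)) \<in> F (fst C) x \<Otimes>\<^sub>M F (snd C) x \<rightarrow>\<^sub>M borel"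
proof -
  note F_facts(3,4)[OF assms, measurable_cong]
  show ?thesis by (simp add: split_beta' borel_prod[symmetric])
qed

lemma prob_space_ker:
  assumes "x \<in> Xs" shows "prob_space (ker x)"
proof -
  interpret A: prob_space "F (fst C) x" by (rule F_facts[OF assms])
  interpret B: prob_space "F (snd C) x" by (rule F_facts[OF assms])
  interpret P: pair_prob_space "F (fst C) x" "F (snd C) x" ..
  show ?thesis unfolding ker_def
    by (rule P.prob_space_distr[OF triple_measurable[OF assms]])
qed

text \<open>The kernel is unconstrained off the support of \<open>G\<close>, so the bind may be over a
  non-measurable map; it is replaced by one that is trivial off \<open>Xs\<close>.\<close>

definition ker' :: "real \<Rightarrow> (real \<times> real \<times> real) measure" where
  "ker' x = (if x \<in> Xs then ker x else return borel (0, 0, 0))"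

lemma ker'_measurable: "ker' \<in> measure_pmf G \<rightarrow>\<^sub>M subprob_algebra borel"
proof -
  have "ker' x \<in> space (subprob_algebra borel)" for x
  proof -
    have "prob_space (ker' x)" unfolding ker'_def
      using prob_space_ker by (auto intro!: prob_space_return)
    moreover have "sets (ker' x) = sets borel" by (simp add: ker'_def ker_def)
    ultimately show ?thesis
      by (simp add: space_subprob_algebra prob_space_imp_subprob_space)
  qed
  then show ?thesis by simp
qed

lemma step_eq_bind: "step F G C = measure_pmf G \<bind> ker'"
proof -
  have s: "sets (ker x) = sets borel" "sets (ker' x) = sets borel" for x
    by (auto simp: ker_def ker'_def)
  \<comment> \<open>\<open>bind_def\<close> reads the target algebra off the value at an arbitrarily
    chosen point, which may lie off \<open>Xs\<close>.\<close>
  have sa: "subprob_algebra (ker x) = subprob_algebra borel"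
    "subprob_algebra (ker' x) = subprob_algebra borel" for x
    using s by (auto intro: subprob_algebra_cong)
  \<comment> \<open>\<open>distr\<close> sees a map only through the measures of its preimages, and
    the two kernels agree almost surely.\<close>
  have "emeasure (measure_pmf G) (ker -` A) = emeasure (measure_pmf G) (ker' -` A)" for A
  proof (rule emeasure_eq_AE)
    show "AE x in measure_pmf G. (x \<in> ker -` A) = (x \<in> ker' -` A)"
      using G_supp by (auto simp: AE_measure_pmf_iff ker'_def)
  qed auto
  then have "distr (measure_pmf G) (subprob_algebra borel) ker
      = distr (measure_pmf G) (subprob_algebra borel) ker'"
    by (simp add: distr_def)
  then show ?thesis
    unfolding step_def ker_def[symmetric] by (simp add: bind_def sa)
qed

lemma sets_step: "sets (step F G C) = sets borel"
  unfolding step_eq_bind by (rule sets_bind) (auto simp: ker'_def ker_def)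

lemma prob_space_step: "prob_space (step F G C)"
  unfolding step_eq_bind
proof (rule prob_space.prob_space_bind)
  show "prob_space (measure_pmf G)" by (rule prob_space_measure_pmf)
  show "AE x in measure_pmf G. prob_space (ker' x)"
    using G_supp prob_space_ker by (auto simp: AE_measure_pmf_iff ker'_def)
qed (rule ker'_measurable)

lemma nn_integral_step:
  assumes "g \<in> borel_measurable borel"
  shows "(\<integral>\<^sup>+s. g s \<partial>step F G C)
    = (\<integral>\<^sup>+x. \<integral>\<^sup>+s. g s \<partial>ker x \<partial>measure_pmf G)"
proof -
  have "(\<integral>\<^sup>+s. g s \<partial>step F G C) = (\<integral>\<^sup>+x. \<integral>\<^sup>+s. g s \<partial>ker' x \<partial>measure_pmf G)"
    unfolding step_eq_bind by (rule nn_integral_bind[OF assms ker'_measurable])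
  also have "\<dots> = (\<integral>\<^sup>+x. \<integral>\<^sup>+s. g s \<partial>ker x \<partial>measure_pmf G)"
    by (rule nn_integral_cong_AE) (use G_supp in \<open>auto simp: AE_measure_pmf_iff ker'_def\<close>)
  finally show ?thesis .
qed

text \<open>The pulled arm reveals one of two independent rewards; the other one integrates to
  \<open>1\<close>. The constant \<open>c\<close> carries the contribution of the past.\<close>

lemma nn_integral_ker_arm:
  assumes x: "x \<in> Xs" and g: "g \<in> borel_measurable borel"
    and W: "W \<in> borel_measurable borel"
    and eq: "\<And>y1 y2. g (x, y1, y2) = c * W (if a = (1::nat) then y1 else y2)"
  shows "(\<integral>\<^sup>+s. g s \<partial>ker x) = c * (\<integral>\<^sup>+y. W y \<partial>F (par C a) x)"
proof -
  interpret A: prob_space "F (fst C) x" by (rule F_facts[OF x])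
  interpret B: prob_space "F (snd C) x" by (rule F_facts[OF x])
  interpret P: pair_prob_space "F (fst C) x" "F (snd C) x" ..
  note F_facts(3,4)[OF x, measurable_cong]
  note W[measurable]
  have "(\<integral>\<^sup>+s. g s \<partial>ker x)
      = (\<integral>\<^sup>+z. g (case z of (y1, y2) \<Rightarrow> (x, y1, y2)) \<partial>(F (fst C) x \<Otimes>\<^sub>M F (snd C) x))"
    unfolding ker_def by (subst nn_integral_distr[OF triple_measurable[OF x]]) (simp_all add: g)
  also have "\<dots> = (\<integral>\<^sup>+z. c * W (if a = 1 then fst z else snd z) \<partial>(F (fst C) x \<Otimes>\<^sub>M F (snd C) x))"
    by (rule nn_integral_cong) (auto simp: eq)
  also have "\<dots> = c * (\<integral>\<^sup>+z. W (if a = 1 then fst z else snd z) \<partial>(F (fst C) x \<Otimes>\<^sub>M F (snd C) x))"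
    by (rule nn_integral_cmult) measurable
  also have "(\<integral>\<^sup>+z. W (if a = 1 then fst z else snd z) \<partial>(F (fst C) x \<Otimes>\<^sub>M F (snd C) x))
      = (\<integral>\<^sup>+y1. \<integral>\<^sup>+y2. W (if a = 1 then y1 else y2) \<partial>F (snd C) x \<partial>F (fst C) x)"
    by (cases "a = 1"; simp; subst B.nn_integral_fst[symmetric]; simp)
  also have "\<dots> = (\<integral>\<^sup>+y. W y \<partial>F (par C a) x)"
    by (auto simp: par_def A.emeasure_space_1 B.emeasure_space_1)
  finally show ?thesis .
qed

lemma nn_integral_ker_const:
  assumes x: "x \<in> Xs" and g: "g \<in> borel_measurable borel" and eq: "\<And>y1 y2. g (x, y1, y2) = c"
  shows "(\<integral>\<^sup>+s. g s \<partial>ker x) = c"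
  using nn_integral_ker_arm[OF x g, of "\<lambda>_. 1" c 1] eq
    prob_space.emeasure_space_1[OF F_prob[OF x, of 1]] by simp

end

subsection \<open>Adaptive sampling\<close>

text \<open>The recorded history omits the arms; they are recovered by replaying the rule.\<close>

definition annotate :: "((nat \<times> real \<times> real) list \<Rightarrow> real \<Rightarrow> nat) \<Rightarrow> (real \<times> real) list
    \<Rightarrow> (nat \<times> real \<times> real) list" where
  "annotate D h = foldl (\<lambda>s (x, y). s @ [(D s x, x, y)]) [] h"

definition policy :: "((nat \<times> real \<times> real) list \<Rightarrow> real \<Rightarrow> nat) \<Rightarrow> (real \<times> real) list \<Rightarrow> real \<Rightarrow> nat" where
  "policy D h x = D (annotate D h) x"

definition obs :: "((nat \<times> real \<times> real) list \<Rightarrow> real \<Rightarrow> nat) \<Rightarrow> (real \<times> real \<times> real) stream \<Rightarrow> nat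
    \<Rightarrow> nat \<times> real \<times> real" where
  "obs D w t = (arm (policy D) w t, Xo w t, Yo (arm (policy D) w t) w t)"

definition past :: "((nat \<times> real \<times> real) list \<Rightarrow> real \<Rightarrow> nat) \<Rightarrow> (real \<times> real \<times> real) stream \<Rightarrow> nat
    \<Rightarrow> (nat \<times> real \<times> real) list" where
  "past D w t = map (obs D w) [0..<t]"

definition stat :: "('a \<Rightarrow> real) \<Rightarrow> 'a list \<Rightarrow> real" where
  "stat f s = sum_list (map f s)"

lemma stat_past: "stat f (past D w t) = (\<Sum>u<t. f (obs D w u))"
  by (induction t) (auto simp: stat_def past_def)

lemma length_past [simp]: "length (past D w t) = t"
  by (simp add: past_def)

text \<open>The replay makes each decision from the list it has rebuilt so far, so by induction it
  reproduces the arms actually pulled. Rules may therefore be designed as if past arms were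
  recorded.\<close>

lemma annotate_hist: "annotate D (hist (policy D) w t) = past D w t"
proof (induction t)
  case (Suc t)
  have "annotate D (h @ [(x, y)]) = annotate D h @ [(D (annotate D h) x, x, y)]" for h x y
    by (simp add: annotate_def)
  moreover have "arm (policy D) w t = D (annotate D (hist (policy D) w t)) (Xo w t)"
    unfolding arm_def policy_def by (rule refl)
  ultimately show ?case
    using Suc by (simp add: past_def obs_def arm_def[symmetric])
qed (simp add: annotate_def past_def)

lemma arm_policy: "arm (policy D) w t = D (past D w t) (Xo w t)"
  by (simp add: arm_def policy_def annotate_hist)

lemma hist_cong: "(\<And>u. u < t \<Longrightarrow> w !! u = w' !! u) \<Longrightarrow> hist pol w t = hist pol w' t"
  by (induction t) (auto simp: Xo_def Yo_def)

text \<open>Data before time \<open>t\<close> do not read entry \<open>t\<close>. This is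
  predictability: factors depending on the past come out of the integral over a redrawn
  entry.\<close>

lemma past_resample: "past D (resample w t s) t = past D w t"
  unfolding annotate_hist[symmetric]
  by (simp add: snth_resample cong: hist_cong)

lemma Xo_resample: "Xo (resample w t s) t = fst s"
  by (simp add: Xo_def snth_resample)

lemma Yo_resample: "Yo a (resample w t s) t = (if a = 1 then fst (snd s) else snd (snd s))"
  by (simp add: Yo_def snth_resample)

lemma measurable_Xo [measurable]: "(\<lambda>w. Xo w t) \<in> borel_measurable (stream_space borel)"
proof -
  have "(\<lambda>w. fst (w !! t)) \<in> stream_space (borel :: (real \<times> real \<times> real) measure) \<rightarrow>\<^sub>M borel"
    by (rule measurable_compose[OF measurable_snth]) (simp add: borel_prod[symmetric])
  then show ?thesis by (simp add: Xo_def)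
qed

lemma measurable_Yo [measurable]: "(\<lambda>w. Yo a w t) \<in> borel_measurable (stream_space borel)"
proof -
  have "(\<lambda>w. fst (snd (w !! t))) \<in> stream_space (borel :: (real \<times> real \<times> real) measure) \<rightarrow>\<^sub>M borel"
    "(\<lambda>w. snd (snd (w !! t))) \<in> stream_space (borel :: (real \<times> real \<times> real) measure) \<rightarrow>\<^sub>M borel"
    by (rule measurable_compose[OF measurable_snth], simp add: borel_prod[symmetric])+
  then show ?thesis by (simp add: Yo_def)
qed

lemma measurable_obs:
  fixes f :: "nat \<times> real \<times> real \<Rightarrow> real"
  assumes [measurable]: "(\<lambda>w. arm (policy D) w t) \<in> stream_space borel \<rightarrow>\<^sub>M count_space UNIV"
    and f: "\<And>a. (\<lambda>(x, y). f (a, x, y)) \<in> borel_measurable borel"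
  shows "(\<lambda>w. f (obs D w t)) \<in> borel_measurable (stream_space borel)"
proof -
  have "(\<lambda>w. (Xo w t, Yo a w t)) \<in> stream_space borel \<rightarrow>\<^sub>M borel" for a
    by (intro borel_measurable_Pair) simp_all
  from measurable_compose[OF this f]
  have *: "(\<lambda>w. f (a, Xo w t, Yo a w t)) \<in> borel_measurable (stream_space borel)" for a by simp
  show ?thesis unfolding obs_def
    by (rule measurable_compose_countable[where f = "\<lambda>a w. f (a, Xo w t, Yo a w t)", OF *]) simp
qed

text \<open>Measurability is asked for each fixed arm; as arms are discrete, this suffices for
  statistics of the observed data.\<close>

definition admissible :: "(nat \<times> real \<times> real \<Rightarrow> real) \<Rightarrow> bool" where
  "admissible f \<longleftrightarrow> (\<forall>a. (\<lambda>(x, y). f (a, x, y)) \<in> borel_measurable borel)"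

lemma admissible_add: "admissible f \<Longrightarrow> admissible g \<Longrightarrow> admissible (\<lambda>z. f z + g z)"
  unfolding admissible_def split_beta' by (intro allI borel_measurable_add; erule spec)

lemma admissible_diff: "admissible f \<Longrightarrow> admissible g \<Longrightarrow> admissible (\<lambda>z. f z - g z)"
  unfolding admissible_def split_beta' by (intro allI borel_measurable_diff; erule spec)

lemma admissible_mult: "admissible f \<Longrightarrow> admissible (\<lambda>z. c * f z)"
  unfolding admissible_def split_beta' by (intro allI borel_measurable_times borel_measurable_const; erule spec)

section \<open>Exponential supermartingales under adaptive sampling\<close>

locale bandit_alg = bandit_env +
  fixes D :: "(nat \<times> real \<times> real) list \<Rightarrow> real \<Rightarrow> nat"
  assumes D_arms: "D s x \<in> {1, 2}"
    and arm_meas [measurable]: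
      "(\<lambda>w. arm (policy D) w t) \<in> stream_space borel \<rightarrow>\<^sub>M count_space UNIV"
begin

abbreviation "\<Omega> \<equiv> Omega F G C"

lemma sets_Omega [measurable_cong]: "sets \<Omega> = sets (stream_space borel)"
  unfolding Omega_def by (rule sets_stream_space_cong[OF sets_step])

lemma space_Omega [simp]: "space \<Omega> = UNIV"
  using sets_eq_imp_space_eq[OF sets_Omega] by (simp add: space_stream_space)

sublocale Om: prob_space \<Omega>
  unfolding Omega_def by (rule prob_space.prob_space_stream_space[OF prob_space_step])

lemma measurable_resample_entry:
  fixes g :: "(real \<times> real \<times> real) stream \<Rightarrow> ennreal"
  assumes "g \<in> borel_measurable (stream_space borel)"
  shows "(\<lambda>s. g (resample w t s)) \<in> borel_measurable borel"
  by (rule measurable_compose[OF measurable_resample assms]) (auto simp: space_stream_space)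

lemma nn_integral_Omega_resample:
  assumes [measurable]: "f \<in> borel_measurable (stream_space borel)"
  shows "(\<integral>\<^sup>+w. f w \<partial>\<Omega>)
    = (\<integral>\<^sup>+w. \<integral>\<^sup>+x. \<integral>\<^sup>+s. f (resample w t s) \<partial>ker x \<partial>measure_pmf G \<partial>\<Omega>)"
proof -
  have "(\<integral>\<^sup>+w. f w \<partial>\<Omega>) = (\<integral>\<^sup>+w. \<integral>\<^sup>+s. f (resample w t s) \<partial>step F G C \<partial>\<Omega>)"
    unfolding Omega_def
    by (rule prob_space.nn_integral_resample[OF prob_space_step])
      (simp add: assms measurable_cong_sets[OF sets_stream_space_cong[OF sets_step] refl])
  also have "\<dots> = (\<integral>\<^sup>+w. \<integral>\<^sup>+x. \<integral>\<^sup>+s. f (resample w t s) \<partial>ker x \<partial>measure_pmf G \<partial>\<Omega>)"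
    by (intro nn_integral_cong nn_integral_step) (simp add: space_stream_space)
  finally show ?thesis .
qed

lemma measurable_obs_admissible [measurable]:
  "admissible f \<Longrightarrow> (\<lambda>w. f (obs D w t)) \<in> borel_measurable (stream_space borel)"
  using measurable_obs[OF arm_meas] by (auto simp: admissible_def)

lemma measurable_stat [measurable]:
  "admissible f \<Longrightarrow> (\<lambda>w. stat f (past D w t)) \<in> borel_measurable (stream_space borel)"
  unfolding stat_past by measurable

text \<open>Redrawing round \<open>t\<close> leaves the past alone, so \<open>exp\<close> of the
  past statistic is a constant factor. Given the context, the arm is determined, and what remains is
  one integral over the reward of that arm, at most \<open>\<rho>\<close>.\<close>

lemma exp_stat_step:
  assumes f: "admissible f"
    and \<rho>: "\<And>a. \<rho> a \<in> borel_measurable borel"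
    and bound: "\<And>a x. a \<in> {1, 2} \<Longrightarrow> x \<in> Xs \<Longrightarrow>
      (\<integral>\<^sup>+y. ennreal (exp (f (a, x, y))) \<partial>F (par C a) x) \<le> \<rho> a x"
  shows "(\<integral>\<^sup>+w. ennreal (exp (stat f (past D w (Suc t)))) \<partial>\<Omega>)
     \<le> (\<integral>\<^sup>+w. ennreal (exp (stat f (past D w t))) * \<rho> (arm (policy D) w t) (Xo w t) \<partial>\<Omega>)"
    (is "?L \<le> ?R")
proof -
  note [measurable] = f
  have [measurable]: "(\<lambda>w. \<rho> (arm (policy D) w t) (Xo w t)) \<in> borel_measurable (stream_space borel)"
    by (rule measurable_compose_countable[where f = "\<lambda>a w. \<rho> a (Xo w t)"])
      (auto intro: measurable_compose[OF measurable_Xo \<rho>])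
  have stat_Suc: "stat f (past D w (Suc t)) = stat f (past D w t) + f (obs D w t)" for w
    by (simp add: stat_past)
  have "(\<integral>\<^sup>+s. ennreal (exp (stat f (past D (resample w t s) (Suc t)))) \<partial>ker x)
     \<le> (\<integral>\<^sup>+s. ennreal (exp (stat f (past D (resample w t s) t)))
          * \<rho> (arm (policy D) (resample w t s) t) (Xo (resample w t s) t) \<partial>ker x)"
    (is "?l \<le> ?r") if x: "x \<in> Xs" for w x
  proof -
    let ?a = "D (past D w t) x" and ?c = "ennreal (exp (stat f (past D w t)))"
    have "(\<lambda>y::real. (x, y)) \<in> borel \<rightarrow>\<^sub>M borel"
      by (rule borel_measurable_Pair[OF borel_measurable_const measurable_ident_sets[OF refl]])
    from measurable_compose[OF this f[unfolded admissible_def, THEN spec, of ?a]]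
    have [measurable]: "(\<lambda>y. f (?a, x, y)) \<in> borel_measurable borel"
      by simp
    have "?l = ?c * (\<integral>\<^sup>+y. ennreal (exp (f (?a, x, y))) \<partial>F (par C ?a) x)"
    proof (rule nn_integral_ker_arm[OF x])
      show "(\<lambda>s. ennreal (exp (stat f (past D (resample w t s) (Suc t))))) \<in> borel_measurable borel"
        by (rule measurable_resample_entry) simp
      show "ennreal (exp (stat f (past D (resample w t (x, y1, y2)) (Suc t)))) =
        ?c * ennreal (exp (f (?a, x, if ?a = 1 then y1 else y2)))" for y1 y2
        unfolding stat_Suc
        by (simp add: past_resample obs_def arm_policy Xo_resample Yo_resample exp_add ennreal_mult)
    qed measurable
    also have "\<dots> \<le> ?c * \<rho> ?a x"
      by (intro mult_left_mono bound D_arms x) auto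
    also have "\<dots> = ?r"
    proof (rule nn_integral_ker_const[OF x, symmetric])
      show "(\<lambda>s. ennreal (exp (stat f (past D (resample w t s) t)))
          * \<rho> (arm (policy D) (resample w t s) t) (Xo (resample w t s) t)) \<in> borel_measurable borel"
        by (rule measurable_resample_entry) simp
    qed (simp add: past_resample arm_policy Xo_resample)
    finally show ?thesis .
  qed
  note le = this
  have "?L = (\<integral>\<^sup>+w. \<integral>\<^sup>+x. \<integral>\<^sup>+s. ennreal (exp (stat f (past D (resample w t s) (Suc t))))
      \<partial>ker x \<partial>measure_pmf G \<partial>\<Omega>)"
    by (rule nn_integral_Omega_resample) simp
  also have "\<dots> \<le> (\<integral>\<^sup>+w. \<integral>\<^sup>+x. \<integral>\<^sup>+s. ennreal (exp (stat f (past D (resample w t s) t)))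
          * \<rho> (arm (policy D) (resample w t s) t) (Xo (resample w t s) t)
      \<partial>ker x \<partial>measure_pmf G \<partial>\<Omega>)"
    by (rule nn_integral_mono, rule nn_integral_mono_AE)
      (use le G_supp in \<open>auto simp: AE_measure_pmf_iff\<close>)
  also have "\<dots> = ?R"
    by (rule nn_integral_Omega_resample[symmetric]) simp
  finally show ?thesis .
qed

lemma exp_stat_le_1:
  assumes "admissible f"
    and "\<And>a x. a \<in> {1, 2} \<Longrightarrow> x \<in> Xs \<Longrightarrow> (\<integral>\<^sup>+y. ennreal (exp (f (a, x, y))) \<partial>F (par C a) x) \<le> 1"
  shows "(\<integral>\<^sup>+w. ennreal (exp (stat f (past D w t))) \<partial>\<Omega>) \<le> 1"
proof (induction t)
  case 0
  then show ?case by (simp add: stat_past Om.emeasure_space_1[simplified])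
next
  case (Suc t)
  then show ?case
    using exp_stat_step[OF assms(1), where \<rho> = "\<lambda>_ _. 1" and t = t] assms(2) by auto
qed

text \<open>With \<open>M t\<close> the expectation of \<open>exp\<close> of the statistic, each
  pull of arm \<open>j\<close> in \<open>S\<close> removes at least the fraction
  \<open>\<delta>\<close> of its weight, so \<open>M (Suc t) + \<delta> * B t \<le> M t\<close>.
  This telescopes from \<open>M 0 = 1\<close>. The set \<open>S\<close> admits increments that decay
  at one context only.\<close>

lemma sum_exp_stat_le:
  assumes f: "admissible f" and \<delta>: "0 < \<delta>" "\<delta> \<le> 1" and S: "S \<in> sets borel"
    and bound1: "\<And>a x. a \<in> {1, 2} \<Longrightarrow> x \<in> Xs \<Longrightarrow>
       (\<integral>\<^sup>+y. ennreal (exp (f (a, x, y))) \<partial>F (par C a) x) \<le> 1"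
    and bound2: "\<And>x. x \<in> Xs \<Longrightarrow> x \<in> S \<Longrightarrow>
       (\<integral>\<^sup>+y. ennreal (exp (f (j, x, y))) \<partial>F (par C j) x) \<le> ennreal (1 - \<delta>)"
  shows "(\<Sum>t<n. \<integral>\<^sup>+w. ennreal (exp (stat f (past D w t)))
            * of_bool (arm (policy D) w t = j \<and> Xo w t \<in> S) \<partial>\<Omega>) \<le> ennreal (1 / \<delta>)"
proof -
  note [measurable] = f S
  define \<rho> where "\<rho> a x = ennreal (1 - \<delta> * of_bool (a = j \<and> x \<in> S))" for a :: nat and x :: real
  define M where "M t = (\<integral>\<^sup>+w. ennreal (exp (stat f (past D w t))) \<partial>\<Omega>)" for t
  define B where "B t = (\<integral>\<^sup>+w. ennreal (exp (stat f (past D w t)))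
            * of_bool (arm (policy D) w t = j \<and> Xo w t \<in> S) \<partial>\<Omega>)" for t
  have [measurable]: "(\<lambda>w. of_bool (arm (policy D) w t = j \<and> Xo w t \<in> S) :: ennreal)
      \<in> borel_measurable (stream_space borel)" for t
    unfolding of_bool_def by measurable
  have step: "M (Suc t) + ennreal \<delta> * B t \<le> M t" for t
  proof -
    have le: "M (Suc t) \<le> (\<integral>\<^sup>+w. ennreal (exp (stat f (past D w t)))
             * \<rho> (arm (policy D) w t) (Xo w t) \<partial>\<Omega>)" (is "_ \<le> ?R")
      unfolding M_def
    proof (rule exp_stat_step[OF f])
      show "\<rho> a \<in> borel_measurable borel" for a
        unfolding \<rho>_def of_bool_def by measurable
      show "(\<integral>\<^sup>+y. ennreal (exp (f (a, x, y))) \<partial>F (par C a) x) \<le> \<rho> a x"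
        if "a \<in> {1, 2}" "x \<in> Xs" for a x
        using bound1[OF that] bound2[OF that(2)] by (auto simp: \<rho>_def)
    qed
    have "?R + ennreal \<delta> * B t = M t"
    proof -
      have "?R + ennreal \<delta> * B t = (\<integral>\<^sup>+w. ennreal (exp (stat f (past D w t)))
             * ennreal (1 - \<delta> * of_bool (arm (policy D) w t = j \<and> Xo w t \<in> S)) \<partial>\<Omega>)
         + (\<integral>\<^sup>+w. ennreal \<delta> * (ennreal (exp (stat f (past D w t)))
            * of_bool (arm (policy D) w t = j \<and> Xo w t \<in> S)) \<partial>\<Omega>)"
        unfolding B_def \<rho>_def by (subst nn_integral_cmult) auto
      also have "\<dots> = (\<integral>\<^sup>+w. ennreal (exp (stat f (past D w t)))
             * ennreal (1 - \<delta> * of_bool (arm (policy D) w t = j \<and> Xo w t \<in> S))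
             + ennreal \<delta> * (ennreal (exp (stat f (past D w t)))
            * of_bool (arm (policy D) w t = j \<and> Xo w t \<in> S)) \<partial>\<Omega>)"
        by (subst nn_integral_add) (auto simp: of_bool_def)
      also have "\<dots> = M t"
        unfolding M_def
      proof (rule nn_integral_cong)
        fix w
        show "ennreal (exp (stat f (past D w t)))
             * ennreal (1 - \<delta> * of_bool (arm (policy D) w t = j \<and> Xo w t \<in> S))
             + ennreal \<delta> * (ennreal (exp (stat f (past D w t)))
            * of_bool (arm (policy D) w t = j \<and> Xo w t \<in> S)) = ennreal (exp (stat f (past D w t)))"
          using \<delta> by (auto simp: of_bool_def ennreal_mult'[symmetric] ennreal_plus[symmetric] algebra_simps
              simp del: ennreal_plus)
      qed
      finally show ?thesis .
    qed
    then show ?thesis using add_right_mono[OF le, of "ennreal \<delta> * B t"] by metis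
  qed
  have "M n + ennreal \<delta> * (\<Sum>t<n. B t) \<le> 1"
  proof (induction n)
    case 0
    then show ?case by (simp add: M_def stat_past Om.emeasure_space_1[simplified])
  next
    case (Suc n)
    have "M (Suc n) + ennreal \<delta> * (\<Sum>t<Suc n. B t) = (M (Suc n) + ennreal \<delta> * B n) + ennreal \<delta> * (\<Sum>t<n. B t)"
      by (simp add: algebra_simps)
    also have "\<dots> \<le> M n + ennreal \<delta> * (\<Sum>t<n. B t)"
      by (intro add_right_mono step)
    finally show ?case using Suc by simp
  qed
  then have "ennreal \<delta> * (\<Sum>t<n. B t) \<le> 1"
    using order_trans[OF add_increasing[OF zero_le order_refl]] by blast
  then have "ennreal (1 / \<delta>) * (ennreal \<delta> * (\<Sum>t<n. B t)) \<le> ennreal (1 / \<delta>) * 1"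
    by (intro mult_left_mono) auto
  then show ?thesis
    using \<delta> by (simp add: B_def mult.assoc[symmetric] ennreal_mult'[symmetric])
qed

text \<open>The past does not read entry \<open>t\<close>, whose context is a fresh draw from
  \<open>G\<close>, so the probability factorizes.\<close>

lemma independent_context:
  assumes P: "Measurable.pred (stream_space borel) (\<lambda>w. P (past D w t))"
  shows "(\<integral>\<^sup>+w. of_bool (P (past D w t) \<and> Xo w t = x) \<partial>\<Omega>)
    = (\<integral>\<^sup>+w. of_bool (P (past D w t)) \<partial>\<Omega>) * ennreal (pmf G x)"
proof -
  note [measurable] = P
  have meas: "(\<lambda>w. of_bool (P (past D w t) \<and> Xo w t = x) :: ennreal) \<in> borel_measurable (stream_space borel)"
    unfolding of_bool_def by measurable
  have "(\<integral>\<^sup>+w. of_bool (P (past D w t) \<and> Xo w t = x) \<partial>\<Omega>)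
     = (\<integral>\<^sup>+w. \<integral>\<^sup>+x'. \<integral>\<^sup>+s. of_bool (P (past D (resample w t s) t) \<and> Xo (resample w t s) t = x)
         \<partial>ker x' \<partial>measure_pmf G \<partial>\<Omega>)"
    by (rule nn_integral_Omega_resample[OF meas])
  also have "\<dots> = (\<integral>\<^sup>+w. \<integral>\<^sup>+x'. of_bool (P (past D w t)) * indicator {x} x' \<partial>measure_pmf G \<partial>\<Omega>)"
    by (intro nn_integral_cong nn_integral_cong_AE AE_pmfI nn_integral_ker_const measurable_resample_entry[OF meas])
      (use G_supp in \<open>auto simp: past_resample Xo_resample\<close>)
  also have "\<dots> = (\<integral>\<^sup>+w. of_bool (P (past D w t)) * ennreal (pmf G x) \<partial>\<Omega>)"
    by (rule nn_integral_cong, subst nn_integral_cmult_indicator) (simp_all add: emeasure_pmf_single)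
  also have "\<dots> = (\<integral>\<^sup>+w. of_bool (P (past D w t)) \<partial>\<Omega>) * ennreal (pmf G x)"
    by (rule nn_integral_multc) (auto simp: of_bool_def)
  finally show ?thesis .
qed

lemma AE_context: "AE w in \<Omega>. Xo w t \<in> Xs"
proof -
  have [measurable]: "Xs \<in> sets borel" using fin_Xs by (simp add: finite_imp_closed borel_closed)
  have meas: "(\<lambda>w. of_bool (Xo w t \<notin> Xs) :: ennreal) \<in> borel_measurable (stream_space borel)"
    unfolding of_bool_def by measurable
  have "(\<integral>\<^sup>+w. of_bool (Xo w t \<notin> Xs) \<partial>\<Omega>)
     = (\<integral>\<^sup>+w. \<integral>\<^sup>+x'. \<integral>\<^sup>+s. of_bool (Xo (resample w t s) t \<notin> Xs) \<partial>ker x' \<partial>measure_pmf G \<partial>\<Omega>)"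
    by (rule nn_integral_Omega_resample[OF meas])
  also have "\<dots> = (\<integral>\<^sup>+w. \<integral>\<^sup>+x'. 0 \<partial>measure_pmf G \<partial>\<Omega>)"
    by (intro nn_integral_cong nn_integral_cong_AE AE_pmfI nn_integral_ker_const measurable_resample_entry[OF meas])
      (use G_supp in \<open>auto simp: Xo_resample\<close>)
  finally have "(\<integral>\<^sup>+w. of_bool (Xo w t \<notin> Xs) \<partial>\<Omega>) = 0" by simp
  then have "AE w in \<Omega>. (of_bool (Xo w t \<notin> Xs) :: ennreal) = 0"
    by (subst (asm) nn_integral_0_iff_AE)
      (simp_all add: meas measurable_cong_sets[OF sets_Omega refl])
  then show ?thesis by eventually_elim (auto split: if_splits)
qed

end

subsection \<open>Log-likelihood ratios\<close>

text \<open>Mutual absolute continuity makes the Radon-Nikodym derivative positive and finite almost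
  everywhere, so its logarithm is a real function and likelihood ratios become differences.\<close>

lemma log_density_exists:
  assumes P: "prob_space P" "sets P = sets N" and N: "prob_space N"
    and ac: "absolutely_continuous N P" "absolutely_continuous P N"
  shows "\<exists>l :: _ \<Rightarrow> real. l \<in> borel_measurable N \<and> P = density N (\<lambda>y. ennreal (exp (l y)))"
proof (intro exI conjI)
  interpret P: prob_space P by fact
  interpret N: prob_space N by fact
  define l where "l = (\<lambda>y. ln (enn2real (RN_deriv N P y)))"
  show "l \<in> borel_measurable N" unfolding l_def by simp
  have P_eq: "density N (RN_deriv N P) = P"
    by (rule N.density_RN_deriv[OF ac(1) P(2)])
  \<comment> \<open>Zeros of the derivative are \<open>P\<close>-null by construction; the second
    absolute continuity makes them \<open>N\<close>-null.\<close>
  have "AE y in density N (RN_deriv N P). RN_deriv N P y \<noteq> 0"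
    by (subst AE_density) auto
  then have "AE y in P. RN_deriv N P y \<noteq> 0" unfolding P_eq .
  then have "AE y in N. RN_deriv N P y \<noteq> 0"
    by (rule absolutely_continuous_AE[OF P(2)[symmetric] ac(2)])
  moreover have "AE y in N. RN_deriv N P y \<noteq> \<infinity>"
    by (rule N.RN_deriv_finite[OF P.sigma_finite_measure_axioms ac(1) P(2)])
  ultimately have "AE y in N. RN_deriv N P y = ennreal (exp (l y))"
  proof eventually_elim
    case (elim y)
    then have "0 < enn2real (RN_deriv N P y)"
      by (simp add: enn2real_positive_iff top.not_eq_extremum zero_less_iff_neq_zero)
    then show ?case
      using elim by (simp add: l_def ennreal_enn2real_if)
  qed
  then have "density N (RN_deriv N P) = density N (\<lambda>y. ennreal (exp (l y)))"
    by (intro density_cong) (auto simp: l_def)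
  then show "P = density N (\<lambda>y. ennreal (exp (l y)))" by (simp add: P_eq)
qed

text \<open>Change of measure: \<open>exp (- a y)\<close> cancels the density of \<open>P\<close>,
  leaving the total mass of \<open>Q\<close>.\<close>

lemma nn_integral_exp_diff:
  assumes [measurable]: "a \<in> borel_measurable N" "b \<in> borel_measurable N"
    and P: "P = density N (\<lambda>y. ennreal (exp (a y)))"
    and Q: "Q = density N (\<lambda>y. ennreal (exp (b y)))" "prob_space Q"
  shows "(\<integral>\<^sup>+y. ennreal (exp (b y - a y)) \<partial>P) = 1"
proof -
  have "(\<integral>\<^sup>+y. ennreal (exp (b y - a y)) \<partial>P) = (\<integral>\<^sup>+y. ennreal (exp (b y)) \<partial>N)"
    unfolding P by (subst nn_integral_density)
      (auto simp: ennreal_mult[symmetric] exp_add[symmetric] intro!: nn_integral_cong)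
  also have "\<dots> = emeasure Q (space Q)"
    unfolding Q(1) by (simp add: emeasure_density cong: nn_integral_cong)
  finally show ?thesis using prob_space.emeasure_space_1[OF Q(2)] by simp
qed

text \<open>Finiteness rules out the infinite branch of \<open>KL\<close>, which provides absolute
  continuity and integrability. Uniqueness of the Radon-Nikodym derivative then identifies the
  entropy density with \<open>a y - b y\<close>; the base \<open>exp 1\<close> makes the logarithm
  natural.\<close>

lemma KL_log_density:
  fixes N P Q :: "real measure"
  assumes m: "a \<in> borel_measurable N" "b \<in> borel_measurable N"
    and P: "P = density N (\<lambda>y. ennreal (exp (a y)))"
    and Q: "Q = density N (\<lambda>y. ennreal (exp (b y)))" "prob_space Q"
    and fin: "KL P Q < \<infinity>"
  shows "integrable P (\<lambda>y. a y - b y)" "KL P Q = ereal (\<integral>y. a y - b y \<partial>P)"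
proof -
  note [measurable] = m
  interpret Q: prob_space Q by fact
  have ac: "absolutely_continuous Q P" and int: "integrable P (entropy_density (exp 1) Q P)"
    and KL: "KL P Q = ereal (KL_divergence (exp 1) Q P)"
    using fin by (auto simp: KL_def split: if_splits)
  have sets: "sets P = sets N" "sets Q = sets N" by (simp_all add: P Q)
  note sets[measurable_cong]
  have "density Q (\<lambda>y. ennreal (exp (a y - b y))) = P"
    unfolding Q(1) P by (subst density_density_eq)
      (auto simp: ennreal_mult[symmetric] exp_add[symmetric] intro!: density_cong)
  then have "AE y in Q. ennreal (exp (a y - b y)) = RN_deriv Q P y"
    by (intro Q.RN_deriv_unique) measurable
  then have "AE y in P. ennreal (exp (a y - b y)) = RN_deriv Q P y"
    by (rule absolutely_continuous_AE[rotated 2]) (simp_all add: sets ac)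
  then have AE: "AE y in P. entropy_density (exp 1) Q P y = a y - b y"
  proof eventually_elim
    case (elim y)
    show ?case
      by (simp add: entropy_density_def elim[symmetric] log_def)
  qed
  have [measurable]: "entropy_density (exp 1) Q P \<in> borel_measurable P"
    using measurable_entropy_density[of "exp 1" Q P]
    by (simp add: measurable_cong_sets[of P Q] sets)
  show "integrable P (\<lambda>y. a y - b y)"
    using int by (rule integrable_cong_AE_imp) (use AE in \<open>auto\<close>)
  show "KL P Q = ereal (\<integral>y. a y - b y \<partial>P)"
    unfolding KL KL_divergence_def using AE by (auto intro!: integral_cong_AE)
qed

text \<open>Only a first moment of \<open>r\<close> is available, but \<open>exp r\<close> is integrable, which is enough to
  differentiate the moment generating function from the right at \<open>0\<close>.\<close>

lemma eventually_mgf_le: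
  fixes r :: "'a \<Rightarrow> real"
  assumes "prob_space P" and int: "integrable P r" and exp: "(\<integral>\<^sup>+y. ennreal (exp (r y)) \<partial>P) \<le> 1"
    and k: "k < - (\<integral>y. r y \<partial>P)"
  shows "\<forall>\<^sub>F n in sequentially.
    (\<integral>\<^sup>+y. ennreal (exp (r y / real (n + 2))) \<partial>P) \<le> ennreal (exp (- k / real (n + 2)))"
proof -
  interpret P: prob_space P by fact
  have [measurable]: "r \<in> borel_measurable P" using int by auto
  define s where "s n = 1 / real (n + 2)" for n
  have s: "0 < s n" "s n \<le> 1" for n by (auto simp: s_def)
  \<comment> \<open>Difference quotient at \<open>0\<close> of the map taking \<open>h\<close> to
    \<open>exp (h * r y)\<close>. It tends to \<open>r y\<close>, and convexity keeps it between
    \<open>r y\<close> and \<open>exp (r y) - 1\<close>, both integrable, so dominated convergence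
    applies.\<close>
  define u where "u n y = (exp (s n * r y) - 1) / s n" for n y
  have u_meas: "u n \<in> borel_measurable P" for n unfolding u_def by measurable
  have int_exp: "integrable P (\<lambda>y. exp (r y))"
    by (rule integrableI_bounded) (use exp in \<open>auto intro: le_less_trans\<close>)
  have lower: "r y \<le> u n y" for n y
    using exp_ge_add_one_self[of "s n * r y"] s[of n] by (simp add: u_def field_simps)
  have upper: "u n y \<le> exp (r y) - 1" for n y
  proof -
    have "exp ((1 - s n) *\<^sub>R 0 + s n *\<^sub>R r y) \<le> (1 - s n) * exp 0 + s n * exp (r y)"
      using s[of n] by (intro convex_onD[OF exp_convex]) auto
    then show ?thesis using s[of n] by (simp add: u_def field_simps)
  qed
  have bound: "norm (u n y) \<le> \<bar>r y\<bar> + exp (r y)" for n y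
    using lower[of y n] upper[of n y] exp_gt_zero[of "r y"] unfolding real_norm_def by linarith
  have lim: "(\<lambda>n. u n y) \<longlonglongrightarrow> r y" for y
  proof -
    have "((\<lambda>h. exp (h * r y)) has_real_derivative r y) (at 0)"
      by (auto intro!: derivative_eq_intros)
    then have "((\<lambda>h. (exp (h * r y) - 1) / h) \<longlongrightarrow> r y) (at 0)"
      by (simp add: has_field_derivative_iff)
    moreover have "filterlim s (at 0) sequentially"
      unfolding s_def by real_asymp
    ultimately show ?thesis
      unfolding u_def by (rule filterlim_compose)
  qed
  have conv: "(\<lambda>n. \<integral>y. u n y \<partial>P) \<longlonglongrightarrow> (\<integral>y. r y \<partial>P)"
  proof (rule integral_dominated_convergence)
    show "integrable P (\<lambda>y. \<bar>r y\<bar> + exp (r y))" using int int_exp by auto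
  qed (simp_all only: lim bound AE_I2 u_meas borel_measurable_integrable[OF int])
  have int_u: "integrable P (u n)" for n
  proof (rule Bochner_Integration.integrable_bound)
    show "integrable P (\<lambda>y. \<bar>r y\<bar> + exp (r y))" using int int_exp by auto
    show "AE y in P. norm (u n y) \<le> norm (\<bar>r y\<bar> + exp (r y))"
      by (rule AE_I2, rule order_trans[OF bound]) simp
  qed (rule u_meas)
  from order_tendstoD(2)[OF conv, of "- k"] k
  have "\<forall>\<^sub>F n in sequentially. (\<integral>y. u n y \<partial>P) < - k" by auto
  then show ?thesis
  proof eventually_elim
    case (elim n)
    \<comment> \<open>The moment generating function at \<open>s n\<close> is affine in the mean of
      \<open>u n\<close>, which is eventually below \<open>- k\<close>; then
      \<open>1 - k * s n \<le> exp (- k * s n)\<close>.\<close>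
    have eq: "exp (r y / real (n + 2)) = 1 + s n * u n y" for y
      using s[of n] by (simp add: u_def s_def)
    have "(\<integral>\<^sup>+y. ennreal (exp (r y / real (n + 2))) \<partial>P) = ennreal (\<integral>y. exp (r y / real (n + 2)) \<partial>P)"
      by (rule nn_integral_eq_integral) (simp_all only: eq int_u integrable_mult_right
          Bochner_Integration.integrable_add P.integrable_const, simp only: eq[symmetric] exp_ge_zero AE_I2)
    also have "(\<integral>y. exp (r y / real (n + 2)) \<partial>P) = 1 + s n * (\<integral>y. u n y \<partial>P)"
      unfolding eq using int_u[of n] by (simp add: P.prob_space)
    also have "\<dots> \<le> 1 + s n * (- k)"
      using elim s[of n] by (intro add_left_mono mult_left_mono) auto
    also have "\<dots> \<le> exp (- k / real (n + 2))"
      using exp_ge_add_one_self[of "- k / real (n + 2)"] by (simp add: s_def)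
    finally show ?case by (simp add: ennreal_leI)
  qed
qed

text \<open>The logarithmic factor makes \<open>1 / thr\<close> summable without changing the asymptotics of
  \<open>ln thr\<close>.\<close>

definition thr :: "nat \<Rightarrow> real" where
  "thr t = real (t + 1) * (1 + ln (real (t + 1)))\<^sup>2"

lemma thr_ge_1: "1 \<le> thr t"
proof -
  have "1 * 1 \<le> thr t" unfolding thr_def
    by (rule mult_mono) (auto intro!: one_le_power)
  then show ?thesis by simp
qed

lemma mono_thr: "t \<le> t' \<Longrightarrow> thr t \<le> thr t'"
  unfolding thr_def by (intro mult_mono power_mono add_left_mono) (auto intro!: ln_mono)

text \<open>Cauchy condensation: at \<open>2 ^ n\<close> the leading factor cancels and the
  logarithm is linear in \<open>n\<close>, leaving a series comparable with the inverse squares. The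
  auxiliary \<open>f\<close> is \<open>1 / thr\<close> shifted by one, so that condensation meets
  exact powers of two.\<close>

lemma summable_inverse_thr: "summable (\<lambda>t. 1 / thr t)"
proof -
  define f where "f n = (if n = 0 then 1 else 1 / (real n * (1 + ln (real n))\<^sup>2))" for n :: nat
  have f_Suc: "f (Suc t) = 1 / thr t" for t by (simp add: f_def thr_def add.commute)
  have "summable f \<longleftrightarrow> summable (\<lambda>n. 2 ^ n * f (2 ^ n))"
  proof (rule condensation_test)
    fix m :: nat assume "0 < m"
    then obtain t where "m = Suc t" by (cases m) auto
    show "f (Suc m) \<le> f m"
      unfolding \<open>m = Suc t\<close> f_Suc
      by (intro divide_left_mono mono_thr mult_pos_pos less_le_trans[OF zero_less_one thr_ge_1]) auto
  qed (auto simp: f_def)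
  also have "(\<lambda>n. 2 ^ n * f (2 ^ n)) = (\<lambda>n. 1 / (1 + real n * ln 2)\<^sup>2)"
  proof
    fix n :: nat
    show "2 ^ n * f (2 ^ n) = 1 / (1 + real n * ln 2)\<^sup>2"
      by (simp add: f_def ln_realpow)
  qed
  finally have *: "summable f \<longleftrightarrow> summable (\<lambda>n. 1 / (1 + real n * ln 2)\<^sup>2)" .
  have "summable (\<lambda>n. 1 / (1 + real n * ln 2)\<^sup>2)"
  proof (rule summable_comparison_test_bigo)
    show "summable (\<lambda>n. norm (1 / real n ^ 2))"
      using inverse_power_summable[of 2, where ?'a = real] by (simp add: inverse_eq_divide)
    show "(\<lambda>n. 1 / (1 + real n * ln 2)\<^sup>2) \<in> O(\<lambda>n. 1 / real n ^ 2)" by real_asymp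
  qed
  with * have "summable f" by (rule iffD2)
  then have "summable (\<lambda>t. f (Suc t))" by (subst summable_Suc_iff)
  then show ?thesis unfolding f_Suc .
qed

lemma ln_thr_asymp: "(\<lambda>t. (b + ln (thr t) / k) / ln (real t)) \<longlonglongrightarrow> 1 / k"
proof -
  have 1: "(\<lambda>t. ln (thr t) / ln (real t)) \<longlonglongrightarrow> 1"
    unfolding thr_def by real_asymp
  have 2: "(\<lambda>t. b / ln (real t)) \<longlonglongrightarrow> 0"
    by real_asymp
  have "(\<lambda>t. b / ln (real t) + (ln (thr t) / ln (real t)) * (1 / k)) \<longlonglongrightarrow> 0 + 1 * (1 / k)"
    by (intro tendsto_intros 1 2)
  moreover have "b / l + (c / l) * (1 / k) = (b + c / k) / l" for l c
    by (simp add: add_divide_distrib)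
  ultimately show ?thesis by simp
qed

subsection \<open>The allocation rule\<close>

lemma stat_diff: "stat f s - stat g s = stat (\<lambda>z. f z - g z) s"
  by (induction s) (auto simp: stat_def)

lemma stat_add: "stat f s + stat g s = stat (\<lambda>z. f z + g z) s"
  by (induction s) (auto simp: stat_def)

lemma stat_mult: "c * stat f s = stat (\<lambda>z. c * f z) s"
  by (induction s) (auto simp: stat_def algebra_simps)

definition hit :: "nat \<Rightarrow> real set \<Rightarrow> nat \<times> real \<times> real \<Rightarrow> real" where
  "hit j S = (\<lambda>(a, x, y). of_bool (a = j \<and> x \<in> S))"

lemma hit_simp: "hit j S (a, x, y) = of_bool (a = j \<and> x \<in> S)"
  by (simp add: hit_def)

lemma hit_measurable:
  assumes "S \<in> sets borel"
  shows "(\<lambda>(x, y). hit j S (a, x, y)) \<in> borel_measurable borel"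
proof -
  have "(\<lambda>z. of_bool (a = j \<and> fst z \<in> S) :: real)
      \<in> borel_measurable (borel \<Otimes>\<^sub>M (borel :: real measure))"
    using assms unfolding of_bool_def by measurable
  then show ?thesis unfolding borel_prod hit_simp split_beta' .
qed

definition pulls :: "nat \<Rightarrow> (nat \<times> real \<times> real) list \<Rightarrow> real" where
  "pulls j = stat (hit j UNIV)"

text \<open>Holds what the rule is built from. \<open>l th x\<close> stands for the log-density of
  \<open>F th x\<close> against a measure common to all parameters at context \<open>x\<close>. The
  true configuration is absent, as the rule must not depend on it.\<close>

locale learner =
  fixes Th Xs :: "real set" and F :: "real \<Rightarrow> real \<Rightarrow> real measure"
    and l :: "real \<Rightarrow> real \<Rightarrow> real \<Rightarrow> real"
  assumes Th_fin: "finite Th" and Th_ne: "Th \<noteq> {}" and Xs_fin: "finite Xs" and Xs_ne: "Xs \<noteq> {}"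
    and l_meas: "\<And>th x. th \<in> Th \<Longrightarrow> x \<in> Xs \<Longrightarrow> l th x \<in> borel_measurable borel"
begin

definition score :: "nat \<Rightarrow> real \<Rightarrow> nat \<times> real \<times> real \<Rightarrow> real" where
  "score j th = (\<lambda>(a, x, y). if a = j \<and> x \<in> Xs then l th x y else 0)"

definition LL :: "nat \<Rightarrow> real \<Rightarrow> (nat \<times> real \<times> real) list \<Rightarrow> real" where
  "LL j th = stat (score j th)"

text \<open>Taking the least maximiser makes the estimate a measurable function of the data.\<close>

definition est :: "nat \<Rightarrow> (nat \<times> real \<times> real) list \<Rightarrow> real" where
  "est j s = Min {th \<in> Th. \<forall>th' \<in> Th. LL j th' s \<le> LL j th s}"

definition better :: "real \<Rightarrow> real set" where
  "better g = {th \<in> Th. \<exists>x0 \<in> Xs. mu F th x0 > mu F g x0}"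

text \<open>A context attaining the supremum in \<open>Ksupinf F Th Xs b g\<close>: sampling there
  separates \<open>b\<close> from every member of \<open>better g\<close> at no less than that
  value.\<close>

definition xstar :: "real \<Rightarrow> real \<Rightarrow> real" where
  "xstar b g = (SOME x. x \<in> Xs \<and>
     (\<forall>x' \<in> Xs. (INF th \<in> better g. KLI F b th x') \<le> (INF th \<in> better g. KLI F b th x)))"

text \<open>\<open>3 - j\<close> is the other arm. The second clause is a sequential test at arm
  \<open>j\<close> of its supposed parameter against those that would make it optimal somewhere; it
  stays open until every one of them is rejected.\<close>

definition acc :: "nat \<Rightarrow> real \<times> real \<Rightarrow> (nat \<times> real \<times> real) list \<Rightarrow> real \<Rightarrow> bool" where
  "acc j C s x \<longleftrightarrow> j \<in> pref F C x \<or>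
     (\<not> revealing F Xs C \<and> x = xstar (par C j) (par C (3 - j)) \<and>
      (\<exists>v \<in> better (par C (3 - j)). LL j (par C j) s - LL j v s < ln (thr (length s))))"

text \<open>Ties go to arm \<open>1\<close>. Off \<open>Xs\<close> the default is arm
  \<open>2\<close>, which keeps the rule measurable, as only finitely many contexts then need
  inspection.\<close>

definition choice :: "(nat \<times> real \<times> real) list \<Rightarrow> real \<Rightarrow> nat" where
  "choice s x = (if x \<in> Xs \<and> acc 1 (est 1 s, est 2 s) s x \<and>
      (\<not> acc 2 (est 1 s, est 2 s) s x \<or> pulls 1 s \<le> pulls 2 s) then 1 else 2)"

lemma mle_set:
  "finite {th \<in> Th. \<forall>th' \<in> Th. LL j th' s \<le> LL j th s}"
  "{th \<in> Th. \<forall>th' \<in> Th. LL j th' s \<le> LL j th s} \<noteq> {}"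
proof -
  show "finite {th \<in> Th. \<forall>th' \<in> Th. LL j th' s \<le> LL j th s}" using Th_fin by simp
  have "Max ((\<lambda>th. LL j th s) ` Th) \<in> (\<lambda>th. LL j th s) ` Th"
    using Th_fin Th_ne by (intro Max_in) auto
  then obtain th where "th \<in> Th" "LL j th s = Max ((\<lambda>th. LL j th s) ` Th)" by auto
  then have "th \<in> {th \<in> Th. \<forall>th' \<in> Th. LL j th' s \<le> LL j th s}"
    using Th_fin by auto
  then show "{th \<in> Th. \<forall>th' \<in> Th. LL j th' s \<le> LL j th s} \<noteq> {}" by blast
qed

lemma est_in: "est j s \<in> Th" and est_max: "th \<in> Th \<Longrightarrow> LL j th s \<le> LL j (est j s) s"
  using Min_in[OF mle_set, of j s] unfolding est_def[symmetric] by auto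

text \<open>Finitely many comparisons of likelihoods characterize the estimate, which gives its
  measurability.\<close>

lemma est_eq_iff: "est j s = th \<longleftrightarrow> th \<in> Th \<and> (\<forall>th' \<in> Th. LL j th' s \<le> LL j th s) \<and>
    (\<forall>v \<in> Th. (\<forall>th' \<in> Th. LL j th' s \<le> LL j v s) \<longrightarrow> th \<le> v)"
  unfolding est_def by (subst Min_eq_iff[OF mle_set]) auto

lemma xstar_in: "xstar b g \<in> Xs"
  and xstar_max: "x \<in> Xs \<Longrightarrow>
    (INF th \<in> better g. KLI F b th x) \<le> (INF th \<in> better g. KLI F b th (xstar b g))"
proof -
  let ?f = "\<lambda>x. INF th \<in> better g. KLI F b th x"
  have "Max (?f ` Xs) \<in> ?f ` Xs" using Xs_fin Xs_ne by (intro Max_in) auto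
  then obtain x where "x \<in> Xs" "?f x = Max (?f ` Xs)" by auto
  then have "\<exists>x. x \<in> Xs \<and> (\<forall>x' \<in> Xs. ?f x' \<le> ?f x)" using Xs_fin by auto
  from someI_ex[OF this] have "xstar b g \<in> Xs \<and> (\<forall>x' \<in> Xs. ?f x' \<le> ?f (xstar b g))"
    unfolding xstar_def .
  then show "xstar b g \<in> Xs" "x \<in> Xs \<Longrightarrow> ?f x \<le> ?f (xstar b g)" for x by auto
qed

lemma pref_nonempty: "1 \<in> pref F C x \<or> 2 \<in> pref F C x"
  by (auto simp: pref_def)

lemma choice_arms: "choice s x \<in> {1, 2}"
  by (simp add: choice_def)

lemma choice_outside: "x \<notin> Xs \<Longrightarrow> choice s x = 2"
  by (simp add: choice_def)

text \<open>Some arm is always preferred at the estimated configuration, so an acceptable arm always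
  exists.\<close>

lemma choice_acc:
  assumes "x \<in> Xs" shows "acc (choice s x) (est 1 s, est 2 s) s x"
proof -
  have "acc 1 (est 1 s, est 2 s) s x \<or> acc 2 (est 1 s, est 2 s) s x"
    using pref_nonempty[of "(est 1 s, est 2 s)" x] unfolding acc_def by blast
  then show ?thesis using assms unfolding choice_def by presburger
qed

text \<open>This is what forces data onto a neglected arm: once acceptable, it is pulled whether or
  not the other arm is acceptable too.\<close>

lemma choice_undersampled:
  assumes "x \<in> Xs" "j \<in> {1, 2}" "acc j (est 1 s, est 2 s) s x" "pulls j s < pulls (3 - j) s"
  shows "choice s x = j"
proof -
  have "j = 1 \<and> 3 - j = 2 \<or> j = 2 \<and> 3 - j = 1" using assms(2) by auto
  then show ?thesis using assms unfolding choice_def by (metis not_le order.strict_implies_order)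
qed

section \<open>Measurability of the rule\<close>

lemma score_measurable:
  assumes "th \<in> Th"
  shows "(\<lambda>(x, y). score j th (a, x, y)) \<in> borel_measurable borel"
proof -
  \<comment> \<open>Only the sections of \<open>l\<close> at fixed contexts are assumed measurable;
    finiteness of \<open>Xs\<close> yields joint measurability.\<close>
  have "(\<lambda>(x, y). score j th (a, x, y))
      = (\<lambda>z. \<Sum>x'\<in>Xs. if a = j \<and> fst z = x' then l th x' (snd z) else 0)"
    using Xs_fin by (auto simp: score_def fun_eq_iff sum.delta intro!: sum.neutral)
  also have "\<dots> \<in> borel_measurable (borel \<Otimes>\<^sub>M borel)"
  proof (rule borel_measurable_sum)
    fix x' assume "x' \<in> Xs"
    note [measurable] = l_meas[OF assms this]
    show "(\<lambda>z. if a = j \<and> fst z = x' then l th x' (snd z) else 0) \<in> borel_measurable (borel \<Otimes>\<^sub>M borel)"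
      by measurable
  qed
  finally show ?thesis unfolding borel_prod .
qed

text \<open>The induction step for measurability of the arms: earlier arms make the statistics
  measurable, and the decision combines finitely many comparisons of them.\<close>

lemma choice_past_measurable:
  assumes arm: "\<And>u. u < t \<Longrightarrow>
    (\<lambda>w. arm (policy choice) w u) \<in> stream_space borel \<rightarrow>\<^sub>M count_space UNIV"
  shows "(\<lambda>w. choice (past choice w t) x) \<in> stream_space borel \<rightarrow>\<^sub>M count_space UNIV"
proof -
  let ?S = "stream_space borel :: (real \<times> real \<times> real) stream measure"
  have stat_m: "(\<lambda>w. stat f (past choice w t)) \<in> borel_measurable ?S"
    if "\<And>a. (\<lambda>(x, y). f (a, x, y)) \<in> borel_measurable borel" for f
    unfolding stat_past by (intro borel_measurable_sum measurable_obs arm that) auto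
  have LL_m [measurable]: "(\<lambda>w. LL j th (past choice w t)) \<in> borel_measurable ?S" if "th \<in> Th" for j th
    unfolding LL_def by (intro stat_m score_measurable that)
  have pulls_m [measurable]: "(\<lambda>w. pulls j (past choice w t)) \<in> borel_measurable ?S" for j
    unfolding pulls_def by (intro stat_m hit_measurable) auto
  have est_m [measurable]: "Measurable.pred ?S (\<lambda>w. est j (past choice w t) = th)" for j th
  proof (cases "th \<in> Th")
    case True
    have le: "Measurable.pred ?S (\<lambda>w. LL j a (past choice w t) \<le> LL j b (past choice w t))"
      if "a \<in> Th" "b \<in> Th" for a b
      using LL_m[OF that(1)] LL_m[OF that(2)] by measurable
    show ?thesis unfolding est_eq_iff
      by (intro pred_intros_logic pred_intros_finite Th_fin le True) simp_all
  next
    case False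
    then have "(\<lambda>w. est j (past choice w t) = th) = (\<lambda>w. False)" using est_in by auto
    then show ?thesis by simp
  qed
  have pulls_le: "Measurable.pred ?S (\<lambda>w. pulls 1 (past choice w t) \<le> pulls 2 (past choice w t))"
    by measurable
  have acc_m [measurable]: "Measurable.pred ?S
      (\<lambda>w. acc j (est 1 (past choice w t), est 2 (past choice w t)) (past choice w t) x)" for j x
  proof -
    have fin: "finite (better g)" for g using Th_fin by (simp add: better_def)
    have sub: "v \<in> better g \<Longrightarrow> v \<in> Th" for v g by (simp add: better_def)
    have acc_m': "Measurable.pred ?S (\<lambda>w. acc j (e1, e2) (past choice w t) x)"
      if "e1 \<in> Th" "e2 \<in> Th" for e1 e2
    proof -
      have [measurable]: "par (e1, e2) j \<in> Th" using that by (simp add: par_def)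
      have "Measurable.pred ?S (\<lambda>w. \<exists>v\<in>better (par (e1, e2) (3 - j)).
          LL j (par (e1, e2) j) (past choice w t) - LL j v (past choice w t) < ln (thr t))"
      proof (rule pred_intros_finite(4)[OF fin])
        fix v assume "v \<in> better (par (e1, e2) (3 - j))"
        note [measurable] = sub[OF this]
        show "Measurable.pred ?S (\<lambda>w. LL j (par (e1, e2) j) (past choice w t)
            - LL j v (past choice w t) < ln (thr t))" by measurable
      qed
      then show ?thesis unfolding acc_def length_past by measurable
    qed
    \<comment> \<open>Fixing the two estimates, which take finitely many values, makes
      \<open>pref\<close>, \<open>better\<close> and \<open>xstar\<close> nonrandom.\<close>
    have "(\<lambda>w. acc j (est 1 (past choice w t), est 2 (past choice w t)) (past choice w t) x)
       = (\<lambda>w. \<exists>e1\<in>Th. \<exists>e2\<in>Th. est 1 (past choice w t) = e1 \<and> est 2 (past choice w t) = e2 \<and>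
            acc j (e1, e2) (past choice w t) x)"
      using est_in by auto
    also have "Measurable.pred ?S \<dots>"
      by (intro pred_intros_logic pred_intros_finite Th_fin est_m acc_m')
    finally show ?thesis .
  qed
  let ?c = "\<lambda>w. x \<in> Xs \<and> acc 1 (est 1 (past choice w t), est 2 (past choice w t)) (past choice w t) x \<and>
      (\<not> acc 2 (est 1 (past choice w t), est 2 (past choice w t)) (past choice w t) x \<or>
        pulls 1 (past choice w t) \<le> pulls 2 (past choice w t))"
  have "Measurable.pred ?S ?c"
    by (intro pred_intros_logic acc_m pulls_le) simp_all
  then have m: "(\<lambda>w. if ?c w then 1 else 2 :: nat) \<in> ?S \<rightarrow>\<^sub>M count_space UNIV"
    unfolding pred_def by (rule measurable_If[OF measurable_const measurable_const, rotated 2]) simp_all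
  have "(\<lambda>w. choice (past choice w t) x) = (\<lambda>w. if ?c w then 1 else 2)"
    by (rule ext, rule choice_def)
  also note m
  finally show ?thesis .
qed

lemma arm_choice_measurable:
  "(\<lambda>w. arm (policy choice) w t) \<in> stream_space borel \<rightarrow>\<^sub>M count_space UNIV"
proof (induction t rule: less_induct)
  case (less t)
  note [measurable] = choice_past_measurable[OF less]
  have "(\<lambda>w. arm (policy choice) w t) =
      (\<lambda>w. if \<exists>x\<in>Xs. Xo w t = x \<and> choice (past choice w t) x = 1 then 1 else 2)"
  proof
    fix w
    show "arm (policy choice) w t =
        (if \<exists>x\<in>Xs. Xo w t = x \<and> choice (past choice w t) x = 1 then 1 else 2)"
      using choice_arms[of "past choice w t" "Xo w t"] choice_outside[of "Xo w t" "past choice w t"]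
      unfolding arm_policy by auto
  qed
  also have "\<dots> \<in> stream_space borel \<rightarrow>\<^sub>M count_space UNIV"
  proof -
    have "Measurable.pred (stream_space borel)
        (\<lambda>w. \<exists>x\<in>Xs. Xo w t = x \<and> choice (past choice w t) x = 1)"
      by (intro pred_intros_finite Xs_fin) measurable
    then show ?thesis
      unfolding pred_def by (rule measurable_If[OF measurable_const measurable_const, rotated 2]) simp_all
  qed
  finally show ?case .
qed

end

subsection \<open>Estimation errors\<close>

context bandit_alg
begin

text \<open>A bound on the expected number of occurrences, which is more than finiteness almost
  surely. Measurability is part of the notion because additivity of the integral needs it in
  unions.\<close>

definition finitely_often :: "(nat \<Rightarrow> (real \<times> real \<times> real) stream \<Rightarrow> bool) \<Rightarrow> bool" where
  "finitely_often E \<longleftrightarrow> (\<forall>t. Measurable.pred (stream_space borel) (E t)) \<and>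
     (\<exists>B::real. \<forall>n. (\<Sum>t<n. \<integral>\<^sup>+w. of_bool (E t w) \<partial>\<Omega>) \<le> ennreal B)"

lemma of_bool_measurable:
  "Measurable.pred (stream_space borel) P \<Longrightarrow>
    (\<lambda>w. of_bool (P w) :: ennreal) \<in> borel_measurable \<Omega>"
  unfolding of_bool_def by measurable

lemma finitely_oftenI:
  assumes "\<And>t. Measurable.pred (stream_space borel) (E t)"
    and "\<And>n. (\<Sum>t<n. \<integral>\<^sup>+w. of_bool (E t w) \<partial>\<Omega>) \<le> ennreal B"
  shows "finitely_often E"
  using assms unfolding finitely_often_def by blast

lemma finitely_often_False: "finitely_often (\<lambda>_ _. False)"
  by (rule finitely_oftenI[where B = 0]) simp_all

lemma finitely_often_disj:
  assumes "finitely_often E" "finitely_often E'"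
  shows "finitely_often (\<lambda>t w. E t w \<or> E' t w)"
proof -
  have m: "Measurable.pred (stream_space borel) (E t)" "Measurable.pred (stream_space borel) (E' t)" for t
    using assms by (auto simp: finitely_often_def)
  obtain B where B: "\<And>n. (\<Sum>t<n. \<integral>\<^sup>+w. of_bool (E t w) \<partial>\<Omega>) \<le> ennreal B"
    using assms(1) by (auto simp: finitely_often_def)
  obtain B' where B': "\<And>n. (\<Sum>t<n. \<integral>\<^sup>+w. of_bool (E' t w) \<partial>\<Omega>) \<le> ennreal B'"
    using assms(2) by (auto simp: finitely_often_def)
  show ?thesis
  \<comment> \<open>\<open>B\<close> may be negative, where \<open>ennreal B\<close> is
    \<open>0\<close>; truncation makes \<open>ennreal\<close> additive on the bounds.\<close>
  proof (rule finitely_oftenI[where B = "max 0 B + max 0 B'"])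
    show "Measurable.pred (stream_space borel) (\<lambda>w. E t w \<or> E' t w)" for t
      using m by measurable
    fix n
    have "(\<Sum>t<n. \<integral>\<^sup>+w. of_bool (E t w \<or> E' t w) \<partial>\<Omega>)
        \<le> (\<Sum>t<n. \<integral>\<^sup>+w. of_bool (E t w) + of_bool (E' t w) \<partial>\<Omega>)"
      by (intro sum_mono nn_integral_mono) (auto simp: of_bool_def)
    also have "\<dots> = (\<Sum>t<n. \<integral>\<^sup>+w. of_bool (E t w) \<partial>\<Omega>) + (\<Sum>t<n. \<integral>\<^sup>+w. of_bool (E' t w) \<partial>\<Omega>)"
      by (subst nn_integral_add) (use m in \<open>auto intro!: of_bool_measurable simp: sum.distrib\<close>)
    also have "\<dots> \<le> ennreal (max 0 B) + ennreal (max 0 B')"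
      using B[of n] B'[of n] by (intro add_mono) (auto intro: order_trans ennreal_leI)
    finally show "(\<Sum>t<n. \<integral>\<^sup>+w. of_bool (E t w \<or> E' t w) \<partial>\<Omega>) \<le> ennreal (max 0 B + max 0 B')"
      by simp
  qed
qed

lemma finitely_often_Bex:
  assumes "finite I" "\<And>i. i \<in> I \<Longrightarrow> finitely_often (E i)"
  shows "finitely_often (\<lambda>t w. \<exists>i\<in>I. E i t w)"
  using assms by (induction I rule: finite_induct)
    (auto simp: finitely_often_False intro: finitely_often_disj)

text \<open>\<open>P\<close> is decided by the past, hence independent of the context at
  \<open>t\<close>. Whenever it holds, context \<open>x\<close> turns it into \<open>E\<close> with
  probability \<open>pmf G x\<close>, so its expected count is at most that of \<open>E\<close>
  divided by \<open>pmf G x\<close>.\<close>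

lemma finitely_often_charge:
  assumes E: "finitely_often E" and x: "pmf G x > 0"
    and m: "\<And>t. Measurable.pred (stream_space borel) (\<lambda>w. P t (past D w t))"
    and imp: "\<And>t w. P t (past D w t) \<Longrightarrow> Xo w t = x \<Longrightarrow> E t w"
  shows "finitely_often (\<lambda>t w. P t (past D w t))"
proof -
  obtain B where B: "\<And>n. (\<Sum>t<n. \<integral>\<^sup>+w. of_bool (E t w) \<partial>\<Omega>) \<le> ennreal B"
    using E by (auto simp: finitely_often_def)
  show ?thesis
  proof (rule finitely_oftenI[OF m, where B = "max 0 B / pmf G x"])
    fix n
    have "(\<Sum>t<n. \<integral>\<^sup>+w. of_bool (P t (past D w t)) \<partial>\<Omega>) * ennreal (pmf G x)
       = (\<Sum>t<n. \<integral>\<^sup>+w. of_bool (P t (past D w t) \<and> Xo w t = x) \<partial>\<Omega>)"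
      unfolding sum_distrib_right by (intro sum.cong refl independent_context[symmetric] m)
    also have "\<dots> \<le> (\<Sum>t<n. \<integral>\<^sup>+w. of_bool (E t w) \<partial>\<Omega>)"
      using imp by (intro sum_mono nn_integral_mono) (auto simp: of_bool_def)
    also have "\<dots> \<le> ennreal (max 0 B)" using B[of n] by (auto intro: order_trans ennreal_leI)
    finally have le: "(\<Sum>t<n. \<integral>\<^sup>+w. of_bool (P t (past D w t)) \<partial>\<Omega>) * ennreal (pmf G x) * ennreal (1 / pmf G x)
        \<le> ennreal (max 0 B) * ennreal (1 / pmf G x)"
      by (rule mult_right_mono) simp
    show "(\<Sum>t<n. \<integral>\<^sup>+w. of_bool (P t (past D w t)) \<partial>\<Omega>) \<le> ennreal (max 0 B / pmf G x)"
    proof -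
      have "ennreal (pmf G x) * ennreal (1 / pmf G x) = 1"
        using x by (subst ennreal_mult[symmetric]) auto
      moreover have "ennreal (max 0 B) * ennreal (1 / pmf G x) = ennreal (max 0 B / pmf G x)"
        by (subst ennreal_mult[symmetric]) auto
      ultimately show ?thesis using le by (simp only: mult.assoc mult_1_right)
    qed
  qed
qed

end

text \<open>Occurrences of \<open>b\<close> stop being counted once \<open>m\<close> of them have
  been seen; the last one counted may overshoot a non-integral \<open>m\<close>, hence
  \<open>m + 1\<close>. The induction needs the sharper bound by the minimum with the total
  count.\<close>

lemma sum_of_bool_count_le:
  fixes m :: real and T :: nat
  assumes "0 \<le> m"
  shows "(\<Sum>t<T. of_bool (b t \<and> (\<Sum>u<t. of_bool (b u)) < m)) \<le> m + 1"
proof -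
  have "(\<Sum>t<T. of_bool (b t \<and> (\<Sum>u<t. of_bool (b u)) < m)) \<le> min (\<Sum>u<T. of_bool (b u)) (m + 1)"
  proof (induction T)
    case (Suc T)
    have "0 \<le> (\<Sum>u<T. of_bool (b u) :: real)" by (intro sum_nonneg) simp
    with Suc assms show ?case
      by (cases "b T"; cases "(\<Sum>u<T. of_bool (b u)) < m") auto
  qed (use assms in simp)
  then show ?thesis by simp
qed

text \<open>The true configuration enters here. \<open>lr_unit\<close> and \<open>lr_mgf\<close>
  carry the likelihood estimates; the latter holds eventually, so that one exponent can serve
  finitely many contexts and rates.\<close>

locale learning = learner Th Xs F l for Th Xs F l +
  fixes G :: "real pmf" and C :: "real \<times> real"
  assumes C_in: "fst C \<in> Th" "snd C \<in> Th"
    and kernel_prob: "\<And>th x. th \<in> Th \<Longrightarrow> x \<in> Xs \<Longrightarrow> prob_space (F th x)"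
    and kernel_sets: "\<And>th x. th \<in> Th \<Longrightarrow> x \<in> Xs \<Longrightarrow> sets (F th x) = sets borel"
    and G_sub: "set_pmf G \<subseteq> Xs" and G_pos: "\<And>x. x \<in> Xs \<Longrightarrow> pmf G x > 0"
    and KL_pos: "\<And>th v x. th \<in> Th \<Longrightarrow> v \<in> Th \<Longrightarrow> th \<noteq> v \<Longrightarrow> x \<in> Xs \<Longrightarrow> 0 < KLI F th v x"
    and lr_unit: "\<And>th v x. th \<in> Th \<Longrightarrow> v \<in> Th \<Longrightarrow> x \<in> Xs \<Longrightarrow>
       (\<integral>\<^sup>+y. ennreal (exp (l v x y - l th x y)) \<partial>F th x) \<le> 1"
    and lr_mgf: "\<And>th v x k. th \<in> Th \<Longrightarrow> v \<in> Th \<Longrightarrow> th \<noteq> v \<Longrightarrow> x \<in> Xs \<Longrightarrow> ereal k < KLI F th v x \<Longrightarrow>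
       \<forall>\<^sub>F n in sequentially.
         (\<integral>\<^sup>+y. ennreal (exp ((l v x y - l th x y) / real (n + 2))) \<partial>F th x)
           \<le> ennreal (exp (- k / real (n + 2)))"
begin

lemma par_in: "par C j \<in> Th"
  using C_in by (simp add: par_def)

sublocale bandit_alg Xs F G C choice
  by (intro bandit_alg.intro bandit_env.intro bandit_alg_axioms.intro)
    (rule kernel_prob kernel_sets par_in G_sub Xs_fin choice_arms arm_choice_measurable | assumption)+

abbreviation "past' w t \<equiv> past choice w t"
abbreviation "arm' w t \<equiv> arm (policy choice) w t"

definition gain :: "nat \<Rightarrow> real \<Rightarrow> nat \<times> real \<times> real \<Rightarrow> real" where
  "gain j v = (\<lambda>z. score j v z - score j (par C j) z)"

lemma stat_gain: "stat (gain j v) s = LL j v s - LL j (par C j) s"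
  by (simp add: gain_def LL_def stat_diff)

lemma gain_simp: "x \<in> Xs \<Longrightarrow>
    gain j v (a, x, y) = (if a = j then l v x y - l (par C j) x y else 0)"
  by (simp add: gain_def score_def)

lemma admissible_gain: "v \<in> Th \<Longrightarrow> admissible (gain j v)"
  unfolding gain_def using par_in
  by (intro admissible_diff) (auto simp: admissible_def intro: score_measurable)

lemma admissible_hit: "S \<in> sets borel \<Longrightarrow> admissible (hit j S)"
  using hit_measurable by (simp add: admissible_def)

lemma LL_measurable: "v \<in> Th \<Longrightarrow> (\<lambda>w. LL j v (past' w t)) \<in> borel_measurable (stream_space borel)"
  unfolding LL_def by (rule measurable_stat) (use score_measurable in \<open>auto simp: admissible_def\<close>)

lemma pulls_measurable: "(\<lambda>w. pulls j (past' w t)) \<in> borel_measurable (stream_space borel)"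
  unfolding pulls_def by (rule measurable_stat) (simp add: admissible_hit)

lemma wrong_measurable:
  assumes "v \<in> Th"
  shows "Measurable.pred (stream_space borel) (\<lambda>w. LL j (par C j) (past' w t) \<le> LL j v (past' w t))"
  using LL_measurable[OF assms, of j t] LL_measurable[OF par_in[of j], of j t] by measurable

lemma pulls_total: "pulls 1 (past' w t) + pulls 2 (past' w t) = real t"
proof (induction t)
  case (Suc t)
  have "arm' w t = 1 \<or> arm' w t = 2"
    using choice_arms by (auto simp: arm_policy)
  then show ?case
    using Suc by (auto simp: pulls_def stat_past obs_def hit_simp)
qed (simp add: pulls_def stat_past)

section \<open>Exceptional events of the rule\<close>

lemma F_unit: "x \<in> Xs \<Longrightarrow> (\<integral>\<^sup>+y. 1 \<partial>F (par C a) x) = 1"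
  using prob_space.emeasure_space_1[OF kernel_prob[OF par_in]] by simp

text \<open>A single exponent serves all contexts, since the log-likelihood pools observations
  from different contexts.\<close>

lemma separation:
  assumes "v \<in> Th" "v \<noteq> par C j"
  shows "\<exists>r c. 0 < r \<and> 0 < c \<and> (\<forall>x\<in>Xs.
    (\<integral>\<^sup>+y. ennreal (exp (r * (l v x y - l (par C j) x y))) \<partial>F (par C j) x) \<le> ennreal (exp (- c)))"
proof -
  let ?K = "\<lambda>x. KLI F (par C j) v x"
  have "0 < Min (?K ` Xs)"
    using Xs_fin Xs_ne assms KL_pos[OF par_in] by (subst Min_gr_iff) auto
  then obtain k where k: "0 < ereal k" "ereal k < Min (?K ` Xs)"
    using ereal_dense2 by blast
  have less: "ereal k < ?K x" if "x \<in> Xs" for x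
    by (rule less_le_trans[OF k(2) Min_le]) (use that Xs_fin in auto)
  have "\<forall>\<^sub>F n in sequentially. \<forall>x\<in>Xs.
      (\<integral>\<^sup>+y. ennreal (exp ((l v x y - l (par C j) x y) / real (n + 2))) \<partial>F (par C j) x)
        \<le> ennreal (exp (- k / real (n + 2)))"
    using assms less by (intro eventually_ball_finite Xs_fin ballI lr_mgf par_in) auto
  then obtain n where n: "\<And>x. x \<in> Xs \<Longrightarrow>
      (\<integral>\<^sup>+y. ennreal (exp ((l v x y - l (par C j) x y) / real (n + 2))) \<partial>F (par C j) x)
        \<le> ennreal (exp (- k / real (n + 2)))"
    by (auto simp: eventually_sequentially)
  show ?thesis
  proof (intro exI conjI ballI)
    show "0 < 1 / real (n + 2)" by simp
    show "0 < k / real (n + 2)" using k(1) by simp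
    fix x assume "x \<in> Xs"
    from n[OF this] show "(\<integral>\<^sup>+y. ennreal (exp (1 / real (n + 2) * (l v x y - l (par C j) x y)))
        \<partial>F (par C j) x) \<le> ennreal (exp (- (k / real (n + 2))))" by simp
  qed
qed

text \<open>While \<open>v\<close> looks at least as likely as the truth, \<open>exp\<close> of a
  positive multiple of the log-likelihood ratio is at least \<open>1\<close>. Each pull of arm
  \<open>j\<close> shrinks this weight on average by a factor of at most \<open>exp (- c)\<close>,
  so \<open>sum_exp_stat_le\<close> applies.\<close>

lemma wrong_pulls:
  assumes v: "v \<in> Th" "v \<noteq> par C j"
  shows "finitely_often (\<lambda>t w. arm' w t = j \<and> LL j (par C j) (past' w t) \<le> LL j v (past' w t))"
proof -
  obtain r c where r: "0 < r" "0 < c" and le: "\<And>x. x \<in> Xs \<Longrightarrow>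
    (\<integral>\<^sup>+y. ennreal (exp (r * (l v x y - l (par C j) x y))) \<partial>F (par C j) x) \<le> ennreal (exp (- c))"
    using separation[OF v] by blast
  define f where "f = (\<lambda>z. r * gain j v z)"
  have f: "admissible f" unfolding f_def by (intro admissible_mult admissible_gain v)
  have f_eq: "f (a, x, y) = (if a = j then r * (l v x y - l (par C j) x y) else 0)" if "x \<in> Xs" for a x y
    using that by (simp add: f_def gain_simp)
  have stat_f: "stat f s = r * (LL j v s - LL j (par C j) s)" for s
    by (simp add: f_def stat_mult[symmetric] stat_gain)
  show ?thesis
  proof (rule finitely_oftenI)
    show "Measurable.pred (stream_space borel)
        (\<lambda>w. arm' w t = j \<and> LL j (par C j) (past' w t) \<le> LL j v (past' w t))" for t
      using wrong_measurable[OF v(1)] by measurable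
    fix n
    have "(\<Sum>t<n. \<integral>\<^sup>+w. of_bool (arm' w t = j \<and> LL j (par C j) (past' w t) \<le> LL j v (past' w t)) \<partial>\<Omega>)
       \<le> (\<Sum>t<n. \<integral>\<^sup>+w. ennreal (exp (stat f (past' w t)))
            * of_bool (arm' w t = j \<and> Xo w t \<in> UNIV) \<partial>\<Omega>)"
    proof (intro sum_mono nn_integral_mono)
      fix t w
      show "of_bool (arm' w t = j \<and> LL j (par C j) (past' w t) \<le> LL j v (past' w t))
         \<le> ennreal (exp (stat f (past' w t))) * of_bool (arm' w t = j \<and> Xo w t \<in> UNIV)"
        using r by (auto simp: stat_f of_bool_def)
    qed
    also have "\<dots> \<le> ennreal (1 / (1 - exp (- c)))"
    proof (rule sum_exp_stat_le[OF f])
      show "0 < 1 - exp (- c)" "1 - exp (- c) \<le> 1" using r by auto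
      show "(\<integral>\<^sup>+y. ennreal (exp (f (j, x, y))) \<partial>F (par C j) x) \<le> ennreal (1 - (1 - exp (- c)))"
        if "x \<in> Xs" for x using le[OF that] that by (simp add: f_eq)
      show "(\<integral>\<^sup>+y. ennreal (exp (f (a, x, y))) \<partial>F (par C a) x) \<le> 1" if "x \<in> Xs" for a x
      proof (cases "a = j")
        case True
        have "ennreal (exp (- c)) \<le> 1" using r by simp
        with True show ?thesis using le[OF that] that by (auto simp: f_eq intro: order_trans)
      qed (simp add: f_eq that F_unit[simplified])
    qed simp
    finally show "(\<Sum>t<n. \<integral>\<^sup>+w. of_bool (arm' w t = j \<and> LL j (par C j) (past' w t) \<le> LL j v (past' w t)) \<partial>\<Omega>)
      \<le> ennreal (1 / (1 - exp (- c)))" .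
  qed
qed

text \<open>Adding \<open>c\<close> per pull to the scaled log-likelihood ratio still leaves an
  exponential mean of at most \<open>1\<close>. On the event the exponent is at least
  \<open>c * t / 2\<close>, so Markov's inequality gives geometrically decaying
  probabilities.\<close>

lemma wrong_oversampled:
  assumes v: "v \<in> Th" "v \<noteq> par C j"
  shows "finitely_often (\<lambda>t w. real t \<le> 2 * pulls j (past' w t) \<and>
    LL j (par C j) (past' w t) \<le> LL j v (past' w t))"
proof -
  obtain r c where r: "0 < r" "0 < c" and le: "\<And>x. x \<in> Xs \<Longrightarrow>
    (\<integral>\<^sup>+y. ennreal (exp (r * (l v x y - l (par C j) x y))) \<partial>F (par C j) x) \<le> ennreal (exp (- c))"
    using separation[OF v] by blast
  define f where "f = (\<lambda>z. r * gain j v z + c * hit j UNIV z)"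
  have f: "admissible f"
    unfolding f_def by (intro admissible_add admissible_mult admissible_gain admissible_hit v) simp
  have f_eq: "f (a, x, y) = (if a = j then c + r * (l v x y - l (par C j) x y) else 0)" if "x \<in> Xs" for a x y
    using that by (simp add: f_def gain_simp hit_simp)
  have stat_f: "stat f s = r * (LL j v s - LL j (par C j) s) + c * pulls j s" for s
    by (simp add: f_def stat_mult[symmetric] stat_add[symmetric] stat_gain pulls_def)
  have exp_le: "(\<integral>\<^sup>+w. ennreal (exp (stat f (past' w t))) \<partial>\<Omega>) \<le> 1" for t
  proof (rule exp_stat_le_1[OF f])
    fix a x assume x: "x \<in> Xs"
    note [measurable] = l_meas[OF v(1) x] l_meas[OF par_in[of j] x]
      kernel_sets[OF par_in[of j] x, measurable_cong]
    show "(\<integral>\<^sup>+y. ennreal (exp (f (a, x, y))) \<partial>F (par C a) x) \<le> 1"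
    proof (cases "a = j")
      case True
      have "(\<integral>\<^sup>+y. ennreal (exp (f (a, x, y))) \<partial>F (par C a) x)
        = (\<integral>\<^sup>+y. ennreal (exp c) * ennreal (exp (r * (l v x y - l (par C j) x y))) \<partial>F (par C j) x)"
        using True x by (simp add: f_eq exp_add ennreal_mult)
      also have "\<dots> = ennreal (exp c) * (\<integral>\<^sup>+y. ennreal (exp (r * (l v x y - l (par C j) x y))) \<partial>F (par C j) x)"
        by (rule nn_integral_cmult) measurable
      also have "\<dots> \<le> ennreal (exp c) * ennreal (exp (- c))"
        by (intro mult_left_mono le x) simp
      also have "\<dots> = 1" by (simp add: ennreal_mult[symmetric] exp_add[symmetric])
      finally show ?thesis .
    qed (simp add: f_eq x F_unit[simplified])
  qed
  define q where "q = exp (- c / 2)"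
  have q: "0 < q" "q < 1" using r by (auto simp: q_def)
  show ?thesis
  proof (rule finitely_oftenI)
    show "Measurable.pred (stream_space borel) (\<lambda>w. real t \<le> 2 * pulls j (past' w t) \<and>
        LL j (par C j) (past' w t) \<le> LL j v (past' w t))" for t
      using wrong_measurable[OF v(1)] pulls_measurable by measurable
    have each: "(\<integral>\<^sup>+w. of_bool (real t \<le> 2 * pulls j (past' w t) \<and>
        LL j (par C j) (past' w t) \<le> LL j v (past' w t)) \<partial>\<Omega>) \<le> ennreal (q ^ t)" for t
    proof -
      have "(\<integral>\<^sup>+w. of_bool (real t \<le> 2 * pulls j (past' w t) \<and>
            LL j (par C j) (past' w t) \<le> LL j v (past' w t)) \<partial>\<Omega>)
         \<le> (\<integral>\<^sup>+w. ennreal (q ^ t) * ennreal (exp (stat f (past' w t))) \<partial>\<Omega>)"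
      proof (rule nn_integral_mono)
        fix w
        have "1 \<le> q ^ t * exp (stat f (past' w t))"
          if A: "real t \<le> 2 * pulls j (past' w t)" "LL j (par C j) (past' w t) \<le> LL j v (past' w t)"
        proof -
          have "q ^ t * exp (stat f (past' w t)) = exp (stat f (past' w t) - real t * (c / 2))"
            by (simp add: q_def exp_of_nat_mult[symmetric] exp_add[symmetric] algebra_simps)
          moreover have "c * (real t / 2) \<le> c * pulls j (past' w t)"
            using A(1) r by (intro mult_left_mono) auto
          moreover have "0 \<le> r * (LL j v (past' w t) - LL j (par C j) (past' w t))"
            using A(2) r by simp
          ultimately show ?thesis by (simp add: stat_f mult.commute)
        qed
        then show "of_bool (real t \<le> 2 * pulls j (past' w t) \<and>
            LL j (par C j) (past' w t) \<le> LL j v (past' w t))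
          \<le> ennreal (q ^ t) * ennreal (exp (stat f (past' w t)))"
          using q by (auto simp: of_bool_def ennreal_mult[symmetric])
      qed
      also have "\<dots> = ennreal (q ^ t) * (\<integral>\<^sup>+w. ennreal (exp (stat f (past' w t))) \<partial>\<Omega>)"
        by (rule nn_integral_cmult) (use measurable_stat[OF f] in measurable)
      also have "\<dots> \<le> ennreal (q ^ t) * 1" by (intro mult_left_mono exp_le) simp
      finally show ?thesis by simp
    qed
    fix n
    have "(\<Sum>t<n. \<integral>\<^sup>+w. of_bool (real t \<le> 2 * pulls j (past' w t) \<and>
        LL j (par C j) (past' w t) \<le> LL j v (past' w t)) \<partial>\<Omega>) \<le> (\<Sum>t<n. ennreal (q ^ t))"
      by (intro sum_mono each)
    also have "\<dots> = ennreal (\<Sum>t<n. q ^ t)" using q by (subst sum_ennreal) auto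
    also have "\<dots> \<le> ennreal (\<Sum>t. q ^ t)"
      using q by (intro ennreal_leI sum_le_suminf summable_geometric) auto
    finally show "(\<Sum>t<n. \<integral>\<^sup>+w. of_bool (real t \<le> 2 * pulls j (past' w t) \<and>
        LL j (par C j) (past' w t) \<le> LL j v (past' w t)) \<partial>\<Omega>) \<le> ennreal (\<Sum>t. q ^ t)" .
  qed
qed

text \<open>The likelihood ratio of \<open>v\<close> against the truth has mean at most
  \<open>1\<close>, so by Markov's inequality it reaches \<open>thr t\<close> with probability at
  most \<open>1 / thr t\<close>, which is summable.\<close>

lemma false_rejections:
  assumes v: "v \<in> Th"
  shows "finitely_often (\<lambda>t w. ln (thr t) \<le> LL j v (past' w t) - LL j (par C j) (past' w t))"
proof -
  have exp_le: "(\<integral>\<^sup>+w. ennreal (exp (stat (gain j v) (past' w t))) \<partial>\<Omega>) \<le> 1" for t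
  proof (rule exp_stat_le_1[OF admissible_gain[OF v]])
    show "(\<integral>\<^sup>+y. ennreal (exp (gain j v (a, x, y))) \<partial>F (par C a) x) \<le> 1" if "x \<in> Xs" for a x
      using lr_unit[OF par_in v that, of j] by (cases "a = j") (simp_all add: gain_simp that F_unit[simplified])
  qed
  have thr_pos: "0 < thr t" for t using thr_ge_1[of t] by simp
  show ?thesis
  proof (rule finitely_oftenI)
    show "Measurable.pred (stream_space borel)
        (\<lambda>w. ln (thr t) \<le> LL j v (past' w t) - LL j (par C j) (past' w t))" for t
      using LL_measurable[OF v] LL_measurable[OF par_in] by measurable
    have each: "(\<integral>\<^sup>+w. of_bool (ln (thr t) \<le> LL j v (past' w t) - LL j (par C j) (past' w t)) \<partial>\<Omega>)
        \<le> ennreal (1 / thr t)" for t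
    proof -
      have "(\<integral>\<^sup>+w. of_bool (ln (thr t) \<le> LL j v (past' w t) - LL j (par C j) (past' w t)) \<partial>\<Omega>)
         \<le> (\<integral>\<^sup>+w. ennreal (1 / thr t) * ennreal (exp (stat (gain j v) (past' w t))) \<partial>\<Omega>)"
      proof (rule nn_integral_mono)
        fix w
        have "1 \<le> 1 / thr t * exp (stat (gain j v) (past' w t))"
          if "ln (thr t) \<le> LL j v (past' w t) - LL j (par C j) (past' w t)"
        proof -
          have "thr t \<le> exp (stat (gain j v) (past' w t))"
            using that thr_pos[of t] by (simp add: stat_gain ln_ge_iff ln_le_cancel_iff[symmetric] del: ln_le_cancel_iff)
          then show ?thesis using thr_pos[of t] by (simp add: field_simps)
        qed
        then show "of_bool (ln (thr t) \<le> LL j v (past' w t) - LL j (par C j) (past' w t))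
          \<le> ennreal (1 / thr t) * ennreal (exp (stat (gain j v) (past' w t)))"
          using thr_pos[of t] by (auto simp: of_bool_def ennreal_mult[symmetric])
      qed
      also have "\<dots> = ennreal (1 / thr t) * (\<integral>\<^sup>+w. ennreal (exp (stat (gain j v) (past' w t))) \<partial>\<Omega>)"
        by (rule nn_integral_cmult) (use measurable_stat[OF admissible_gain[OF v]] in measurable)
      also have "\<dots> \<le> ennreal (1 / thr t) * 1" by (intro mult_left_mono exp_le) simp
      finally show ?thesis by simp
    qed
    fix n
    have "(\<Sum>t<n. \<integral>\<^sup>+w. of_bool (ln (thr t) \<le> LL j v (past' w t) - LL j (par C j) (past' w t)) \<partial>\<Omega>)
        \<le> (\<Sum>t<n. ennreal (1 / thr t))"
      by (intro sum_mono each)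
    also have "\<dots> = ennreal (\<Sum>t<n. 1 / thr t)"
      using thr_pos by (subst sum_ennreal) (auto intro: less_imp_le)
    also have "\<dots> \<le> ennreal (\<Sum>t. 1 / thr t)"
      using thr_pos by (intro ennreal_leI sum_le_suminf summable_inverse_thr) (auto intro: less_imp_le)
    finally show "(\<Sum>t<n. \<integral>\<^sup>+w. of_bool (ln (thr t) \<le> LL j v (past' w t) - LL j (par C j) (past' w t)) \<partial>\<Omega>)
      \<le> ennreal (\<Sum>t. 1 / thr t)" .
  qed
qed

text \<open>Readiness to pull arm \<open>j\<close> at context \<open>x\<close> is decided by the
  past; when that context arrives, it becomes a wrong pull, which \<open>wrong_pulls\<close>
  controls.\<close>

lemma wrong_willing:
  assumes v: "v \<in> Th" "v \<noteq> par C j" and x: "x \<in> Xs"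
  shows "finitely_often (\<lambda>t w. choice (past' w t) x = j \<and>
    LL j (par C j) (past' w t) \<le> LL j v (past' w t))"
proof (rule finitely_often_charge[OF wrong_pulls[OF v] G_pos[OF x],
      where P = "\<lambda>t s. choice s x = j \<and> LL j (par C j) s \<le> LL j v s"])
  show "Measurable.pred (stream_space borel) (\<lambda>w. choice (past' w t) x = j \<and>
    LL j (par C j) (past' w t) \<le> LL j v (past' w t))" for t
    using wrong_measurable[OF v(1)] choice_past_measurable[OF arm_choice_measurable] by measurable
qed (auto simp: arm_policy)

text \<open>In order: a wrong likelihood comparison at the pulled arm, at an arm with at least half
  of the pulls, at an arm that would be pulled in some context, and a rejection of the true
  parameter.\<close>

definition mistake :: "nat \<Rightarrow> (real \<times> real \<times> real) stream \<Rightarrow> bool" where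
  "mistake t w \<longleftrightarrow> (\<exists>j\<in>{1, 2}. \<exists>v\<in>Th - {par C j}.
     (arm' w t = j \<and> LL j (par C j) (past' w t) \<le> LL j v (past' w t)) \<or>
     (real t \<le> 2 * pulls j (past' w t) \<and> LL j (par C j) (past' w t) \<le> LL j v (past' w t)) \<or>
     (\<exists>x\<in>Xs. choice (past' w t) x = j \<and> LL j (par C j) (past' w t) \<le> LL j v (past' w t)) \<or>
     ln (thr t) \<le> LL j v (past' w t) - LL j (par C j) (past' w t))"

lemma finitely_often_mistake: "finitely_often mistake"
proof -
  have "finitely_often (\<lambda>t w. mistake t w)"
    unfolding mistake_def
    by (intro finitely_often_Bex finitely_often_disj wrong_pulls wrong_oversampled wrong_willing
        false_rejections) (use Th_fin Xs_fin in auto)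
  then show ?thesis by simp
qed

definition exploring :: "nat \<Rightarrow> (real \<times> real \<times> real) stream \<Rightarrow> bool" where
  "exploring t w \<longleftrightarrow> \<not> revealing F Xs C \<and> arm' w t \<notin> pref F C (Xo w t) \<and>
     Xo w t = xstar (par C (arm' w t)) (par C (3 - arm' w t)) \<and>
     (\<exists>v\<in>better (par C (3 - arm' w t)).
        LL (arm' w t) (par C (arm' w t)) (past' w t) - LL (arm' w t) v (past' w t) < ln (thr t))"

text \<open>Outside \<open>mistake\<close> the pulled arm has a correct estimate. If the other one
  did not, it would have fewer pulls, hence be unacceptable at every context, so its true parameter
  would have been rejected, again a mistake. With both estimates correct, an inferior arm is
  acceptable only through the testing clause of \<open>acc\<close>.\<close>

lemma inferior_pull_cases:
  assumes X: "Xo w t \<in> Xs" and inf: "arm' w t \<notin> pref F C (Xo w t)" and ok: "\<not> mistake t w"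
  shows "exploring t w"
proof -
  define a where "a = arm' w t"
  define j where "j = 3 - a"
  define s where "s = past' w t"
  define E where "E = (est 1 s, est 2 s)"
  have a: "a \<in> {1, 2}" unfolding a_def arm_policy by (rule choice_arms)
  have j: "j \<in> {1, 2}" "3 - j = a" "a \<noteq> j" using a by (auto simp: j_def)
  have a_eq: "a = choice s (Xo w t)" by (simp add: a_def s_def arm_policy)
  have par_E: "par E i = est i s" if "i \<in> {1, 2}" for i
    using that by (auto simp: E_def par_def)
  have ok': "\<not> (a = i \<and> LL i (par C i) s \<le> LL i v s)"
      "\<not> (real t \<le> 2 * pulls i s \<and> LL i (par C i) s \<le> LL i v s)"
      "\<not> (\<exists>x\<in>Xs. choice s x = i \<and> LL i (par C i) s \<le> LL i v s)"
      "\<not> ln (thr t) \<le> LL i v s - LL i (par C i) s"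
    if "i \<in> {1, 2}" "v \<in> Th" "v \<noteq> par C i" for i v
    using ok that unfolding mistake_def s_def a_def by blast+
  have wrong: "LL i (par C i) s \<le> LL i (est i s) s" for i
    by (rule est_max[OF par_in])
  have est_a: "est a s = par C a"
    using ok'(1)[OF a est_in] wrong by blast
  have est_j: "est j s = par C j"
  proof (rule ccontr)
    assume ne: "est j s \<noteq> par C j"
    have "\<not> real t \<le> 2 * pulls j s"
      using ok'(2)[OF j(1) est_in ne] wrong by blast
    moreover have "pulls j s + pulls a s = real t"
      using pulls_total[of w t] a j unfolding s_def j_def by auto
    ultimately have less: "pulls j s < pulls (3 - j) s" using j by simp
    \<comment> \<open>Were arm \<open>j\<close> acceptable at some context, being undersampled it
      would be chosen there, with a wrong estimate.\<close>
    have not_acc: "\<not> acc j E s x" if "x \<in> Xs" for x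
      using ok'(3)[OF j(1) est_in ne] wrong choice_undersampled[OF that j(1) _ less] that
      unfolding E_def by blast
    then have not_pref: "j \<notin> pref F E x" if "x \<in> Xs" for x
      using that unfolding acc_def by blast
    then have "\<not> revealing F Xs E"
      using j(1) unfolding revealing_def by auto
    \<comment> \<open>Unacceptability at \<open>xstar\<close> means that the test there has closed:
      every competitor has been rejected.\<close>
    then have "\<not> (\<exists>v\<in>better (par E (3 - j)). LL j (par E j) s - LL j v s < ln (thr (length s)))"
      using not_acc[OF xstar_in[of "par E j" "par E (3 - j)"]] unfolding acc_def by blast
    \<comment> \<open>Arm \<open>a\<close> is inferior at the current context and its estimate is
      correct, so the true parameter of arm \<open>j\<close> has the larger mean there.\<close>
    moreover have "par C j \<in> better (par E (3 - j))"
      using inf X par_in[of j] a j est_a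
      unfolding a_def[symmetric] better_def pref_def j(2) par_E[OF a] by (auto simp: not_le)
    ultimately have "\<not> LL j (est j s) s - LL j (par C j) s < ln (thr t)"
      unfolding par_E[OF j(1)] by (auto simp: s_def)
    then show False using ok'(4)[OF j(1) est_in ne] by simp
  qed
  have "E = C"
    using est_a est_j a j by (auto simp: E_def par_def prod_eq_iff)
  then have "acc a C s (Xo w t)"
    using choice_acc[OF X, of s] by (simp add: a_eq E_def)
  then show ?thesis
    using inf unfolding exploring_def acc_def a_def[symmetric] s_def[symmetric]
    by (simp add: s_def)
qed

text \<open>The exponent adds \<open>k\<close> per pull at \<open>x0\<close> to the log-likelihood
  ratio of \<open>v\<close>. On the event it is nonnegative, since the ratio lost less than
  \<open>ln (thr t) \<le> ln (thr T)\<close> and the pulls at \<open>x0\<close> make up for this. As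
  \<open>k\<close> is below the information at \<open>x0\<close>, each pull there shrinks the
  weight, and the bound is uniform in \<open>T\<close>.\<close>

lemma exploration_tail:
  assumes v: "v \<in> Th" "v \<noteq> par C i" and x0: "x0 \<in> Xs"
    and k: "0 < k" "ereal k < KLI F (par C i) v x0"
  shows "\<exists>B::real. \<forall>T. (\<Sum>t<T. \<integral>\<^sup>+w. of_bool (arm' w t = i \<and> Xo w t = x0 \<and>
      LL i (par C i) (past' w t) - LL i v (past' w t) < ln (thr t) \<and>
      ln (thr T) \<le> k * stat (hit i {x0}) (past' w t)) \<partial>\<Omega>) \<le> ennreal B"
proof -
  \<comment> \<open>The gap between \<open>k\<close> and \<open>k'\<close> is what makes the weight
    shrink at \<open>x0\<close>. At the other contexts rate \<open>0\<close> suffices, where the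
    weight need not shrink; one common \<open>n\<close> serves both demands.\<close>
  obtain k' where k': "ereal k < ereal k'" "ereal k' < KLI F (par C i) v x0"
    using ereal_dense2[OF k(2)] by blast
  have "\<forall>\<^sub>F n in sequentially. \<forall>x\<in>Xs.
      (\<integral>\<^sup>+y. ennreal (exp ((l v x y - l (par C i) x y) / real (n + 2))) \<partial>F (par C i) x)
        \<le> ennreal (exp (- 0 / real (n + 2)))"
    using v KL_pos[OF par_in] by (intro eventually_ball_finite Xs_fin ballI lr_mgf par_in) (auto simp: zero_ereal_def[symmetric])
  moreover have "\<forall>\<^sub>F n in sequentially.
      (\<integral>\<^sup>+y. ennreal (exp ((l v x0 y - l (par C i) x0 y) / real (n + 2))) \<partial>F (par C i) x0)
        \<le> ennreal (exp (- k' / real (n + 2)))"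
    using v k' x0 by (intro lr_mgf par_in) auto
  ultimately have "\<forall>\<^sub>F n in sequentially. (\<forall>x\<in>Xs.
      (\<integral>\<^sup>+y. ennreal (exp ((l v x y - l (par C i) x y) / real (n + 2))) \<partial>F (par C i) x) \<le> 1) \<and>
      (\<integral>\<^sup>+y. ennreal (exp ((l v x0 y - l (par C i) x0 y) / real (n + 2))) \<partial>F (par C i) x0)
        \<le> ennreal (exp (- k' / real (n + 2)))"
    by eventually_elim simp
  then obtain n where n1: "\<And>x. x \<in> Xs \<Longrightarrow>
      (\<integral>\<^sup>+y. ennreal (exp ((l v x y - l (par C i) x y) / real (n + 2))) \<partial>F (par C i) x) \<le> 1"
    and n2: "(\<integral>\<^sup>+y. ennreal (exp ((l v x0 y - l (par C i) x0 y) / real (n + 2))) \<partial>F (par C i) x0)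
        \<le> ennreal (exp (- k' / real (n + 2)))"
    unfolding eventually_sequentially by blast
  define r where "r = 1 / real (n + 2)"
  have r: "0 < r" by (simp add: r_def)
  define f where "f = (\<lambda>z. r * gain i v z + (r * k) * hit i {x0} z)"
  have f: "admissible f"
    unfolding f_def by (intro admissible_add admissible_mult admissible_gain admissible_hit v) simp
  have f_eq: "f (a, x, y) = (if a = i then r * (l v x y - l (par C i) x y) + (if x = x0 then r * k else 0) else 0)"
    if "x \<in> Xs" for a x y
    using that by (simp add: f_def gain_simp hit_simp)
  have stat_f: "stat f s = r * (LL i v s - LL i (par C i) s + k * stat (hit i {x0}) s)" for s
    by (simp add: f_def stat_mult[symmetric] stat_add[symmetric] stat_gain algebra_simps)
  define \<delta> where "\<delta> = 1 - exp (r * (k - k'))"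
  have \<delta>: "0 < \<delta>" "\<delta> \<le> 1" using k'(1) r by (auto simp: \<delta>_def mult_pos_neg)
  have at_x0: "(\<integral>\<^sup>+y. ennreal (exp (f (i, x0, y))) \<partial>F (par C i) x0) \<le> ennreal (1 - \<delta>)"
  proof -
    note [measurable] = l_meas[OF v(1) x0] l_meas[OF par_in[of i] x0]
      kernel_sets[OF par_in[of i] x0, measurable_cong]
    have "(\<integral>\<^sup>+y. ennreal (exp (f (i, x0, y))) \<partial>F (par C i) x0)
      = (\<integral>\<^sup>+y. ennreal (exp (r * k)) * ennreal (exp ((l v x0 y - l (par C i) x0 y) / real (n + 2))) \<partial>F (par C i) x0)"
      using x0 by (intro nn_integral_cong)
        (simp add: f_eq r_def ennreal_mult[symmetric] exp_add[symmetric] add.commute)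
    also have "\<dots> = ennreal (exp (r * k)) *
        (\<integral>\<^sup>+y. ennreal (exp ((l v x0 y - l (par C i) x0 y) / real (n + 2))) \<partial>F (par C i) x0)"
      by (rule nn_integral_cmult) measurable
    also have "\<dots> \<le> ennreal (exp (r * k)) * ennreal (exp (- k' / real (n + 2)))"
      by (intro mult_left_mono n2) simp
    also have "\<dots> = ennreal (1 - \<delta>)"
      by (simp add: \<delta>_def r_def ennreal_mult[symmetric] exp_add[symmetric] diff_divide_distrib)
    finally show ?thesis .
  qed
  have all: "(\<integral>\<^sup>+y. ennreal (exp (f (a, x, y))) \<partial>F (par C a) x) \<le> 1" if x: "x \<in> Xs" for a x
  proof -
    consider "a \<noteq> i" | "a = i" "x = x0" | "a = i" "x \<noteq> x0" by blast
    then show ?thesis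
    proof cases
      case 1
      then show ?thesis by (simp add: f_eq x F_unit[simplified])
    next
      case 2
      have "ennreal (1 - \<delta>) \<le> 1" using \<delta> by simp
      with at_x0 2 show ?thesis by (auto intro: order_trans)
    next
      case 3
      with n1[OF x] x show ?thesis by (simp add: f_eq r_def)
    qed
  qed
  show ?thesis
  proof (intro exI[of _ "1 / \<delta>"] allI)
    fix T
    have "(\<Sum>t<T. \<integral>\<^sup>+w. of_bool (arm' w t = i \<and> Xo w t = x0 \<and>
      LL i (par C i) (past' w t) - LL i v (past' w t) < ln (thr t) \<and>
      ln (thr T) \<le> k * stat (hit i {x0}) (past' w t)) \<partial>\<Omega>)
      \<le> (\<Sum>t<T. \<integral>\<^sup>+w. ennreal (exp (stat f (past' w t))) * of_bool (arm' w t = i \<and> Xo w t \<in> {x0}) \<partial>\<Omega>)"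
    proof (intro sum_mono nn_integral_mono)
      fix t w assume t: "t \<in> {..<T}"
      have "ln (thr t) \<le> ln (thr T)"
        using t thr_ge_1[of t] thr_ge_1[of T] mono_thr[of t T] by simp
      then have "0 \<le> stat f (past' w t)"
        if "LL i (par C i) (past' w t) - LL i v (past' w t) < ln (thr t)"
          "ln (thr T) \<le> k * stat (hit i {x0}) (past' w t)"
        using that r unfolding stat_f by (intro mult_nonneg_nonneg) auto
      then show "of_bool (arm' w t = i \<and> Xo w t = x0 \<and>
          LL i (par C i) (past' w t) - LL i v (past' w t) < ln (thr t) \<and>
          ln (thr T) \<le> k * stat (hit i {x0}) (past' w t))
        \<le> ennreal (exp (stat f (past' w t))) * of_bool (arm' w t = i \<and> Xo w t \<in> {x0})"
        by (auto simp: of_bool_def)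
    qed
    also have "\<dots> \<le> ennreal (1 / \<delta>)"
      by (rule sum_exp_stat_le[OF f \<delta>]) (use all at_x0 in auto)
    finally show "(\<Sum>t<T. \<integral>\<^sup>+w. of_bool (arm' w t = i \<and> Xo w t = x0 \<and>
      LL i (par C i) (past' w t) - LL i v (past' w t) < ln (thr t) \<and>
      ln (thr T) \<le> k * stat (hit i {x0}) (past' w t)) \<partial>\<Omega>) \<le> ennreal (1 / \<delta>)" .
  qed
qed

end

subsection \<open>Regret\<close>

text \<open>The hypothesis gives the bound \<open>1 / k\<close> for each admissible
  \<open>k\<close>; then \<open>k\<close> tends to \<open>K\<close>. For
  \<open>K = \<infinity>\<close> this yields \<open>0\<close>, in agreement with
  \<open>1 / \<infinity> = 0\<close>.\<close>

lemma limsup_le_inverse: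
  fixes e :: "nat \<Rightarrow> real" and K :: ereal
  assumes K: "0 < K" and bound: "\<And>k. 0 < k \<Longrightarrow> ereal k < K \<Longrightarrow> \<exists>B. \<forall>T. e T \<le> B + ln (thr T) / k"
  shows "limsup (\<lambda>t. ereal (e t / ln (real t))) \<le> 1 / K"
proof -
  have le: "limsup (\<lambda>t. ereal (e t / ln (real t))) \<le> ereal (1 / k)" if k: "0 < k" "ereal k < K" for k
  proof -
    obtain B where B: "\<And>T. e T \<le> B + ln (thr T) / k" using bound[OF k] by blast
    have "limsup (\<lambda>t. ereal (e t / ln (real t))) \<le> limsup (\<lambda>t. ereal ((B + ln (thr t) / k) / ln (real t)))"
    proof (rule Limsup_mono)
      show "\<forall>\<^sub>F t in sequentially. ereal (e t / ln (real t)) \<le> ereal ((B + ln (thr t) / k) / ln (real t))"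
        using eventually_ge_at_top[of 1]
        by eventually_elim (auto intro!: divide_right_mono B)
    qed
    also have "\<dots> = ereal (1 / k)"
      by (rule lim_imp_Limsup) (auto intro: ln_thr_asymp)
    finally show ?thesis .
  qed
  show ?thesis
  proof (cases K)
    case (real r)
    then have r: "0 < r" using K by simp
    have "(\<lambda>n. ereal (1 / (r * (1 - 1 / real (n + 2))))) \<longlonglongrightarrow> ereal (1 / r)"
      by (rule tendsto_ereal, use r in real_asymp, simp add: inverse_eq_divide)
    then have "limsup (\<lambda>t. ereal (e t / ln (real t))) \<le> ereal (1 / r)"
    proof (rule LIMSEQ_le_const, intro exI allI impI)
      fix n :: nat
      have "0 < r * (1 - 1 / real (n + 2))" "r * (1 - 1 / real (n + 2)) < r"
        using r by (auto simp: field_simps intro!: add_pos_nonneg)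
      then show "limsup (\<lambda>t. ereal (e t / ln (real t))) \<le> ereal (1 / (r * (1 - 1 / real (n + 2))))"
        using real by (intro le) auto
    qed
    then show ?thesis using real r by (simp add: one_ereal_def)
  next
    case PInf
    have "(\<lambda>n. ereal (1 / real (n + 1))) \<longlonglongrightarrow> ereal 0"
      by (rule tendsto_ereal) real_asymp
    then have "limsup (\<lambda>t. ereal (e t / ln (real t))) \<le> ereal 0"
    proof (rule LIMSEQ_le_const, intro exI allI impI)
      show "limsup (\<lambda>t. ereal (e t / ln (real t))) \<le> ereal (1 / real (n + 1))" for n :: nat
        using PInf by (intro le) auto
    qed
    then show ?thesis using PInf by (simp add: zero_ereal_def)
  qed (use K in simp)
qed

lemma sum_of_bool_ennreal: "(\<Sum>t\<in>A. of_bool (P t) :: ennreal) = ennreal (\<Sum>t\<in>A. of_bool (P t))"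
proof -
  have "(of_bool Q :: ennreal) = ennreal (of_bool Q)" for Q by (cases Q) simp_all
  then have "(\<Sum>t\<in>A. of_bool (P t) :: ennreal) = (\<Sum>t\<in>A. ennreal (of_bool (P t)))"
    by (rule sum.cong[OF refl])
  also have "\<dots> = ennreal (\<Sum>t\<in>A. of_bool (P t))" by (rule sum_ennreal) simp
  finally show ?thesis .
qed

section \<open>Regret as an expected count of inferior pulls\<close>

context learning
begin

abbreviation "inferior t w \<equiv> arm' w t \<notin> pref F C (Xo w t)"
abbreviation "regret T \<equiv> ETinf F G C (policy choice) T"

lemma Tinf_eq_sum: "real (Tinf F C (policy choice) w T) = (\<Sum>t<T. of_bool (inferior t w))"
proof -
  have "{tau. tau < T \<and> inferior tau w} = {tau \<in> {..<T}. inferior tau w}" by auto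
  then show ?thesis
    unfolding Tinf_def by (simp add: sum.If_cases Int_def of_bool_def)
qed

text \<open>The means, and hence the preferred arm, need not depend measurably on contexts outside
  \<open>Xs\<close>. If they do not, \<open>Tinf\<close> is non-measurable at every positive time, and its Bochner
  integral has the junk value \<open>0\<close>.\<close>

lemma inferior_measurable:
  assumes S: "{x. x \<notin> Xs \<and> 2 \<notin> pref F C x} \<in> sets borel"
  shows "Measurable.pred (stream_space borel) (inferior t)"
proof -
  \<comment> \<open>Contexts in \<open>Xs\<close> are finitely many; off \<open>Xs\<close> the arm
    is always \<open>2\<close>, so inferiority depends on the context alone.\<close>
  have "inferior t = (\<lambda>w. (\<exists>x\<in>Xs. Xo w t = x \<and> arm' w t \<notin> pref F C x) \<or>
      Xo w t \<in> {x. x \<notin> Xs \<and> 2 \<notin> pref F C x})"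
  proof
    fix w
    show "inferior t w = ((\<exists>x\<in>Xs. Xo w t = x \<and> arm' w t \<notin> pref F C x) \<or>
      Xo w t \<in> {x. x \<notin> Xs \<and> 2 \<notin> pref F C x})"
    proof (cases "Xo w t \<in> Xs")
      case False
      show ?thesis using choice_outside[OF False, of "past' w t"] False by (simp add: arm_policy)
    qed auto
  qed
  also have "Measurable.pred (stream_space borel) \<dots>"
  proof -
    have [measurable]: "Measurable.pred (stream_space borel)
        (\<lambda>w. \<exists>x\<in>Xs. Xo w t = x \<and> arm' w t \<notin> pref F C x)"
      by (rule pred_intros_finite(4)[OF Xs_fin]) measurable
    have [measurable]: "Measurable.pred (stream_space borel)
        (\<lambda>w. Xo w t \<in> {x. x \<notin> Xs \<and> 2 \<notin> pref F C x})"
      by (rule pred_sets2[OF S measurable_Xo])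
    show ?thesis by measurable
  qed
  finally show ?thesis .
qed

text \<open>Everything hinges on whether one set of contexts off \<open>Xs\<close> is Borel. If it
  is not, then for positive \<open>T\<close> freezing all rounds but the last and varying the last
  context would recover the set from a measurable \<open>Tinf\<close>; so \<open>Tinf\<close> is not
  integrable and its integral is \<open>0\<close>.\<close>

lemma regret_cases:
  obtains (junk) "\<And>T. regret T = 0"
  | (genuine) "\<And>t. Measurable.pred (stream_space borel) (inferior t)"
proof (cases "{x. x \<notin> Xs \<and> 2 \<notin> pref F C x} \<in> sets borel")
  case True
  then show ?thesis using inferior_measurable genuine by blast
next
  case False
  have "regret T = 0" for T
  proof (cases T)
    case (Suc n)
    have "(\<lambda>w. \<Sum>t<Suc n. of_bool (inferior t w) :: real) \<notin> borel_measurable \<Omega>"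
    proof
      assume "(\<lambda>w. \<Sum>t<Suc n. of_bool (inferior t w) :: real) \<in> borel_measurable \<Omega>"
      then have mS: "(\<lambda>w. \<Sum>t<Suc n. of_bool (inferior t w) :: real) \<in> borel_measurable (stream_space borel)"
        by (simp add: measurable_cong_sets[OF sets_Omega refl])
      \<comment> \<open>Base stream; the curve \<open>?w\<close> changes only its context in round
        \<open>n\<close> and is measurable in that context.\<close>
      define w0 where "w0 = (sconst (0, 0, 0) :: (real \<times> real \<times> real) stream)"
      define c where "c = (\<Sum>t<n. of_bool (inferior t w0) :: real)"
      let ?w = "\<lambda>x. resample w0 n (x, 0, 0)"
      have "(\<lambda>x::real. (x, 0::real, 0::real)) \<in> borel \<rightarrow>\<^sub>M borel"
        by (intro borel_measurable_Pair borel_measurable_const measurable_ident_sets refl)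
      then have "(\<lambda>x. ?w x) \<in> borel \<rightarrow>\<^sub>M stream_space borel"
        by (intro measurable_resample) (auto simp: space_stream_space)
      from measurable_compose[OF this mS]
      have [measurable]: "(\<lambda>x. \<Sum>t<Suc n. of_bool (inferior t (?w x)) :: real) \<in> borel_measurable borel" .
      have obs: "obs choice (?w x) t = obs choice w0 t" if "t < n" for t x
      proof -
        have "past choice (?w x) n ! t = past choice w0 n ! t"
          by (simp only: past_resample)
        then show ?thesis using that by (simp add: past_def)
      qed
      have "inferior t (?w x) = inferior t w0" if "t < n" for t x
        using obs[OF that, of x] by (auto simp: obs_def)
      then have sum_eq: "(\<Sum>t<Suc n. of_bool (inferior t (?w x)) :: real) = c + of_bool (inferior n (?w x))" for x
        by (simp add: c_def)
      have last: "inferior n (?w x) \<longleftrightarrow> 2 \<notin> pref F C x" if "x \<notin> Xs" for x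
        using choice_outside[OF that] by (simp add: arm_policy Xo_resample)
      have [measurable]: "Xs \<in> sets borel" using Xs_fin by (simp add: finite_imp_closed borel_closed)
      have "{x. x \<notin> Xs \<and> 2 \<notin> pref F C x}
          = {x \<in> space borel. x \<notin> Xs \<and> (\<Sum>t<Suc n. of_bool (inferior t (?w x)) :: real) = c + 1}"
        unfolding sum_eq using last by (auto simp: of_bool_def)
      also have "\<dots> \<in> sets borel" by measurable
      finally show False using False by simp
    qed
    then have "\<not> integrable \<Omega> (\<lambda>w. \<Sum>t<Suc n. of_bool (inferior t w) :: real)"
      by blast
    then show ?thesis
      unfolding ETinf_def Tinf_eq_sum Suc by (rule not_integrable_integral_eq)
  qed (simp add: ETinf_def Tinf_def)
  then show ?thesis by (rule junk)
qed

lemma regret_eq_sum: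
  assumes m: "\<And>t. Measurable.pred (stream_space borel) (inferior t)"
  shows "ennreal (regret T) = (\<Sum>t<T. \<integral>\<^sup>+w. of_bool (inferior t w) \<partial>\<Omega>)"
proof -
  have bm: "(\<lambda>w. of_bool (inferior t w) :: real) \<in> borel_measurable \<Omega>" for t
    using m[of t] unfolding of_bool_def by measurable
  have "integrable \<Omega> (\<lambda>w. \<Sum>t<T. of_bool (inferior t w) :: real)"
    by (intro Bochner_Integration.integrable_sum Om.integrable_const_bound[where B = 1] bm) auto
  then have "ennreal (regret T) = (\<integral>\<^sup>+w. ennreal (\<Sum>t<T. of_bool (inferior t w)) \<partial>\<Omega>)"
    unfolding ETinf_def Tinf_eq_sum
    by (intro nn_integral_eq_integral[symmetric]) (auto intro!: sum_nonneg)
  also have "\<dots> = (\<integral>\<^sup>+w. (\<Sum>t<T. of_bool (inferior t w)) \<partial>\<Omega>)"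
    by (simp only: sum_of_bool_ennreal)
  also have "\<dots> = (\<Sum>t<T. \<integral>\<^sup>+w. of_bool (inferior t w) \<partial>\<Omega>)"
    by (rule nn_integral_sum) (rule of_bool_measurable[OF m])
  finally show ?thesis .
qed

lemma regret_mono:
  assumes "\<And>t. Measurable.pred (stream_space borel) (inferior t)"
  shows "incseq regret"
proof (rule incseq_SucI)
  fix T
  have le: "ennreal (regret T) \<le> ennreal (regret (Suc T))"
    unfolding regret_eq_sum[OF assms] by (simp add: add_increasing2)
  have "0 \<le> regret (Suc T)" by (simp add: ETinf_def)
  with le show "regret T \<le> regret (Suc T)" by (simp only: ennreal_le_iff)
qed

lemma AE_inferior: "AE w in \<Omega>. inferior t w \<longrightarrow> mistake t w \<or> (Xo w t \<in> Xs \<and> exploring t w)"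
  using AE_context[of t] by eventually_elim (use inferior_pull_cases in blast)

text \<open>Exploring pulls occur only at configurations that are not revealing, so the regret is
  bounded by the expected number of mistakes. Being increasing, it converges.\<close>

lemma regret_revealing:
  assumes "revealing F Xs C"
  shows "\<exists>L. regret \<longlonglongrightarrow> L"
proof (cases rule: regret_cases)
  case junk
  then show ?thesis by (simp add: exI[of _ 0])
next
  case genuine
  obtain B where B: "\<And>n. (\<Sum>t<n. \<integral>\<^sup>+w. of_bool (mistake t w) \<partial>\<Omega>) \<le> ennreal B"
    using finitely_often_mistake by (auto simp: finitely_often_def)
  have "regret T \<le> max 0 B" for T
  proof -
    have "ennreal (regret T) \<le> (\<Sum>t<T. \<integral>\<^sup>+w. of_bool (mistake t w) \<partial>\<Omega>)"
      unfolding regret_eq_sum[OF genuine]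
    proof (intro sum_mono nn_integral_mono_AE)
      show "AE w in \<Omega>. (of_bool (inferior t w) :: ennreal) \<le> of_bool (mistake t w)" for t
        using AE_inferior[of t] by eventually_elim (use assms in \<open>auto simp: exploring_def of_bool_def\<close>)
    qed
    also have "\<dots> \<le> ennreal (max 0 B)" using B[of T] by (auto intro: order_trans ennreal_leI)
    finally have "ennreal (regret T) \<le> ennreal (max 0 B)" .
    then show ?thesis by (subst (asm) ennreal_le_iff) simp_all
  qed
  then show ?thesis
    using incseq_convergent[OF regret_mono[OF genuine]] by metis
qed

text \<open>Inferior pulls beyond the mistakes are exploring pulls of the inferior arm at the
  context \<open>x0\<close>. Those preceded by fewer than \<open>ln (thr T) / k\<close> pulls there
  are counted pathwise; for the later ones \<open>exploration_tail\<close> applies to each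
  competitor that may keep the test open.\<close>

lemma regret_exploring:
  assumes g: "g \<in> {1, 2}" and pref: "\<And>x. x \<in> Xs \<Longrightarrow> pref F C x = {g}" and k: "0 < k"
    and KL: "\<And>v. v \<in> better (par C g) \<Longrightarrow>
      ereal k < KLI F (par C (3 - g)) v (xstar (par C (3 - g)) (par C g))"
  shows "\<exists>B. \<forall>T. regret T \<le> B + ln (thr T) / k"
proof (cases rule: regret_cases)
  case junk
  then show ?thesis using k thr_ge_1 by (intro exI[of _ 0]) simp
next
  case genuine
  define b where "b = 3 - g"
  have b: "b \<in> {1, 2}" "3 - b = g" "b \<noteq> g" using g by (auto simp: b_def)
  define x0 where "x0 = xstar (par C b) (par C g)"
  have x0: "x0 \<in> Xs" by (simp add: x0_def xstar_in)
  define R where "R T v t w \<longleftrightarrow> arm' w t = b \<and> Xo w t = x0 \<and>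
      LL b (par C b) (past' w t) - LL b v (past' w t) < ln (thr t) \<and>
      ln (thr T) \<le> k * stat (hit b {x0}) (past' w t)" for T v t w
  define Q where "Q T t w \<longleftrightarrow> arm' w t = b \<and> Xo w t = x0 \<and>
      stat (hit b {x0}) (past' w t) < ln (thr T) / k" for T t w
  have finB: "finite (better (par C g))" using Th_fin by (simp add: better_def)
  have vB: "v \<in> Th" "v \<noteq> par C b" if v: "v \<in> better (par C g)" for v
  proof -
    show "v \<in> Th" using v by (simp add: better_def)
    obtain x where x: "x \<in> Xs" "mu F v x > mu F (par C g) x" using v by (auto simp: better_def)
    have "g \<in> pref F C x" using pref[OF x(1)] by simp
    then have "mu F (par C b) x \<le> mu F (par C g) x" using b by (auto simp: pref_def)
    then show "v \<noteq> par C b" using x by auto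
  qed
  have "\<exists>B::real. \<forall>T. (\<Sum>t<T. \<integral>\<^sup>+w. of_bool (R T v t w) \<partial>\<Omega>) \<le> ennreal B"
    if v: "v \<in> better (par C g)" for v
    unfolding R_def by (rule exploration_tail[OF vB[OF v] x0 k]) (use KL[OF v] in \<open>simp add: x0_def b_def\<close>)
  then obtain BR where BR: "\<And>v T. v \<in> better (par C g) \<Longrightarrow>
      (\<Sum>t<T. \<integral>\<^sup>+w. of_bool (R T v t w) \<partial>\<Omega>) \<le> ennreal (BR v)"
    by metis
  obtain BM where BM: "\<And>n. (\<Sum>t<n. \<integral>\<^sup>+w. of_bool (mistake t w) \<partial>\<Omega>) \<le> ennreal BM"
    using finitely_often_mistake by (auto simp: finitely_often_def)
  have [measurable]: "(\<lambda>w. stat (hit b {x0}) (past' w t)) \<in> borel_measurable (stream_space borel)" for t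
    by (rule measurable_stat) (simp add: admissible_hit)
  have mM: "(\<lambda>w. of_bool (mistake t w) :: ennreal) \<in> borel_measurable \<Omega>" for t
    using finitely_often_mistake by (intro of_bool_measurable) (simp add: finitely_often_def)
  have mQ: "(\<lambda>w. of_bool (Q T t w) :: ennreal) \<in> borel_measurable \<Omega>" for t T
    unfolding Q_def by (intro of_bool_measurable) measurable
  have mR: "(\<lambda>w. of_bool (R T v t w) :: ennreal) \<in> borel_measurable \<Omega>" if "v \<in> better (par C g)" for t T v
  proof -
    note [measurable] = LL_measurable[OF vB(1)[OF that]] LL_measurable[OF par_in]
    show ?thesis unfolding R_def by (intro of_bool_measurable) measurable
  qed
  have Q_sum: "(\<Sum>t<T. \<integral>\<^sup>+w. of_bool (Q T t w) \<partial>\<Omega>) \<le> ennreal (ln (thr T) / k + 1)" for T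
  proof -
    have nn: "0 \<le> ln (thr T) / k" using thr_ge_1[of T] k by simp
    have "(\<Sum>t<T. \<integral>\<^sup>+w. of_bool (Q T t w) \<partial>\<Omega>) = (\<integral>\<^sup>+w. (\<Sum>t<T. of_bool (Q T t w)) \<partial>\<Omega>)"
      by (rule nn_integral_sum[symmetric]) (rule mQ)
    also have "\<dots> \<le> (\<integral>\<^sup>+w. ennreal (ln (thr T) / k + 1) \<partial>\<Omega>)"
    proof (rule nn_integral_mono)
      fix w
      have "(\<Sum>t<T. of_bool (Q T t w) :: real)
          = (\<Sum>t<T. of_bool ((arm' w t = b \<and> Xo w t = x0) \<and>
              (\<Sum>u<t. of_bool (arm' w u = b \<and> Xo w u = x0)) < ln (thr T) / k))"
        by (intro sum.cong refl) (simp add: Q_def stat_past obs_def hit_simp)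
      also have "\<dots> \<le> ln (thr T) / k + 1"
        by (rule sum_of_bool_count_le[OF nn])
      finally show "(\<Sum>t<T. of_bool (Q T t w) :: ennreal) \<le> ennreal (ln (thr T) / k + 1)"
        unfolding sum_of_bool_ennreal by (rule ennreal_leI)
    qed
    also have "\<dots> = ennreal (ln (thr T) / k + 1)" using Om.emeasure_space_1 by simp
    finally show ?thesis .
  qed
  \<comment> \<open>The summand \<open>1\<close> is the overshoot in the pathwise count.\<close>
  define B where "B = max 0 BM + 1 + (\<Sum>v\<in>better (par C g). max 0 (BR v))"
  have "regret T \<le> B + ln (thr T) / k" for T
  proof -
    have nn: "0 \<le> ln (thr T) / k" using thr_ge_1[of T] k by simp
    have "ennreal (regret T) \<le> (\<Sum>t<T. \<integral>\<^sup>+w. of_bool (mistake t w) + (of_bool (Q T t w)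
        + (\<Sum>v\<in>better (par C g). of_bool (R T v t w))) \<partial>\<Omega>)"
      unfolding regret_eq_sum[OF genuine]
    proof (intro sum_mono nn_integral_mono_AE)
      fix t
      show "AE w in \<Omega>. (of_bool (inferior t w) :: ennreal) \<le> of_bool (mistake t w) + (of_bool (Q T t w)
        + (\<Sum>v\<in>better (par C g). of_bool (R T v t w)))"
        using AE_inferior[of t]
      proof eventually_elim
        case (elim w)
        show ?case
        proof (cases "inferior t w \<and> \<not> mistake t w")
          case True
          then have X: "Xo w t \<in> Xs" and E: "exploring t w" using elim by auto
          have "arm' w t \<in> {1, 2}" unfolding arm_policy by (rule choice_arms)
          moreover have "arm' w t \<noteq> g" using True unfolding pref[OF X] by blast
          ultimately have a: "arm' w t = b" using b(1,3) g by blast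
          have X0: "Xo w t = x0" and "\<exists>v\<in>better (par C g).
              LL b (par C b) (past' w t) - LL b v (past' w t) < ln (thr t)"
            using E unfolding exploring_def a b(2) x0_def by blast+
          then obtain v where v: "v \<in> better (par C g)"
            "LL b (par C b) (past' w t) - LL b v (past' w t) < ln (thr t)" by blast
          show ?thesis
          proof (cases "Q T t w")
            case False
            then have "R T v t w"
              using v(2) X0 a k unfolding R_def Q_def not_less by (simp add: not_less field_simps)
            then have "(1::ennreal) \<le> (\<Sum>v\<in>better (par C g). of_bool (R T v t w))"
              using member_le_sum[OF v(1), of "\<lambda>v. of_bool (R T v t w) :: ennreal"] finB by simp
            then show ?thesis using True False by (auto intro: order_trans)
          qed (use True in \<open>simp add: add_increasing2\<close>)
        qed (auto simp: add_increasing2)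
      qed
    qed
    also have "\<dots> = (\<Sum>t<T. \<integral>\<^sup>+w. of_bool (mistake t w) \<partial>\<Omega>) + ((\<Sum>t<T. \<integral>\<^sup>+w. of_bool (Q T t w) \<partial>\<Omega>)
        + (\<Sum>v\<in>better (par C g). \<Sum>t<T. \<integral>\<^sup>+w. of_bool (R T v t w) \<partial>\<Omega>))"
    proof -
      have "(\<integral>\<^sup>+w. of_bool (mistake t w) + (of_bool (Q T t w)
        + (\<Sum>v\<in>better (par C g). of_bool (R T v t w))) \<partial>\<Omega>) = (\<integral>\<^sup>+w. of_bool (mistake t w) \<partial>\<Omega>) +
          ((\<integral>\<^sup>+w. of_bool (Q T t w) \<partial>\<Omega>) + (\<Sum>v\<in>better (par C g). \<integral>\<^sup>+w. of_bool (R T v t w) \<partial>\<Omega>))" for t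
        using mM mQ mR by (simp add: nn_integral_add nn_integral_sum)
      then show ?thesis
        by (simp add: sum.distrib sum.swap[of _ "better (par C g)"])
    qed
    also have "\<dots> \<le> ennreal (max 0 BM) + (ennreal (ln (thr T) / k + 1)
        + (\<Sum>v\<in>better (par C g). ennreal (max 0 (BR v))))"
    proof (intro add_mono sum_mono Q_sum)
      show "(\<Sum>t<T. \<integral>\<^sup>+w. of_bool (mistake t w) \<partial>\<Omega>) \<le> ennreal (max 0 BM)"
        using BM[of T] by (auto intro: order_trans ennreal_leI)
      show "(\<Sum>t<T. \<integral>\<^sup>+w. of_bool (R T v t w) \<partial>\<Omega>) \<le> ennreal (max 0 (BR v))"
        if "v \<in> better (par C g)" for v
        using BR[OF that, of T] by (auto intro: order_trans ennreal_leI)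
    qed
    also have "\<dots> = ennreal (B + ln (thr T) / k)"
    proof -
      have add: "ennreal m + (ennreal x + ennreal y) = ennreal (m + (x + y))"
        if "0 \<le> m" "0 \<le> x" "0 \<le> y" for m x y
        using that by simp
      have "(\<Sum>v\<in>better (par C g). ennreal (max 0 (BR v))) = ennreal (\<Sum>v\<in>better (par C g). max 0 (BR v))"
        by (rule sum_ennreal) (rule max.cobounded1)
      moreover have "0 \<le> (\<Sum>v\<in>better (par C g). max 0 (BR v))"
        by (rule sum_nonneg) (rule max.cobounded1)
      moreover have "0 \<le> ln (thr T) / k + 1" using nn by simp
      moreover have "max 0 BM + (ln (thr T) / k + 1 + (\<Sum>v\<in>better (par C g). max 0 (BR v)))
          = B + ln (thr T) / k"
        unfolding B_def by linarith
      ultimately show ?thesis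
        using add[OF max.cobounded1] by metis
    qed
    finally have le: "ennreal (regret T) \<le> ennreal (B + ln (thr T) / k)" .
    have "0 \<le> B + ln (thr T) / k" using nn by (simp add: B_def sum_nonneg)
    with le show ?thesis by (simp only: ennreal_le_iff)
  qed
  then show ?thesis by blast
qed

text \<open>By maximality of \<open>xstar\<close>, every competitor has information at least
  \<open>Ksupinf\<close> there, so each positive \<open>k\<close> below that value is admissible.
  Exploring at a single context yields the sup-inf value; the saddle point condition enters only in
  the theorem.\<close>

lemma regret_nonrevealing:
  assumes g: "g \<in> {1, 2}" and pref: "\<And>x. x \<in> Xs \<Longrightarrow> pref F C x = {g}"
  shows "limsup (\<lambda>t. ereal (regret t / ln (real t))) \<le> 1 / Ksupinf F Th Xs (par C (3 - g)) (par C g)"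
proof -
  let ?b = "par C (3 - g)" and ?g = "par C g"
  have K_eq: "Ksupinf F Th Xs ?b ?g = (SUP x \<in> Xs. INF v \<in> better ?g. KLI F ?b v x)"
    by (simp add: Ksupinf_def better_def)
  have K_le: "Ksupinf F Th Xs ?b ?g \<le> KLI F ?b v (xstar ?b ?g)" if "v \<in> better ?g" for v
  proof -
    have "Ksupinf F Th Xs ?b ?g \<le> (INF v \<in> better ?g. KLI F ?b v (xstar ?b ?g))"
      unfolding K_eq by (intro SUP_least xstar_max)
    also have "\<dots> \<le> KLI F ?b v (xstar ?b ?g)" using that by (rule INF_lower)
    finally show ?thesis .
  qed
  have "0 < (INF v \<in> better ?g. KLI F ?b v (xstar ?b ?g))"
  \<comment> \<open>Without competitors the infimum is \<open>\<infinity>\<close>; otherwise it is a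
    minimum of finitely many positive numbers.\<close>
  proof (cases "better ?g = {}")
    case False
    have "KLI F ?b v (xstar ?b ?g) > 0" if v: "v \<in> better ?g" for v
    proof (rule KL_pos[OF par_in _ _ xstar_in])
      show "v \<in> Th" using v by (simp add: better_def)
      obtain x where x: "x \<in> Xs" "mu F v x > mu F ?g x" using v by (auto simp: better_def)
      have "g \<in> pref F C x" using pref[OF x(1)] by simp
      moreover have "3 - g \<in> {1, 2}" using g by auto
      ultimately have "mu F ?b x \<le> mu F ?g x" unfolding pref_def by blast
      then show "?b \<noteq> v" using x by auto
    qed
    then show ?thesis
      using False Th_fin by (subst finite_less_Inf_iff) (auto simp: better_def)
  qed (simp add: top_ereal_def)
  also have "\<dots> \<le> Ksupinf F Th Xs ?b ?g"
    unfolding K_eq by (intro SUP_upper xstar_in)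
  finally have pos: "0 < Ksupinf F Th Xs ?b ?g" .
  show ?thesis
  proof (rule limsup_le_inverse[OF pos])
    fix k assume k: "0 < k" "ereal k < Ksupinf F Th Xs ?b ?g"
    show "\<exists>B. \<forall>T. regret T \<le> B + ln (thr T) / k"
      by (rule regret_exploring[OF g pref k(1)]) (auto intro: less_le_trans[OF k(2) K_le])
  qed
qed

end

section \<open>A common dominating measure, and the theorem\<close>

lemma KL_finite_imp_absolutely_continuous: "KL P Q < \<infinity> \<Longrightarrow> absolutely_continuous Q P"
  by (auto simp: KL_def split: if_splits)

text \<open>Finite divergences in both directions make all laws at one context mutually absolutely
  continuous, so a fixed member of the family serves as the dominating measure, with real
  log-densities.\<close>

lemma log_densities:
  assumes kernel: "\<And>th x. th \<in> Th \<Longrightarrow> x \<in> Xs \<Longrightarrow> prob_space (F th x) \<and> sets (F th x) = sets borel"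
    and KL_fin: "\<And>th v x. th \<in> Th \<Longrightarrow> v \<in> Th \<Longrightarrow> th \<noteq> v \<Longrightarrow> x \<in> Xs \<Longrightarrow> KLI F th v x < \<infinity>"
    and th0: "th0 \<in> Th"
  shows "\<exists>l :: real \<Rightarrow> real \<Rightarrow> real \<Rightarrow> real. \<forall>th\<in>Th. \<forall>x\<in>Xs. l th x \<in> borel_measurable (F th0 x) \<and>
     F th x = density (F th0 x) (\<lambda>y. ennreal (exp (l th x y)))"
proof -
  have "\<exists>h :: real \<Rightarrow> real. h \<in> borel_measurable (F th0 x) \<and>
      F th x = density (F th0 x) (\<lambda>y. ennreal (exp (h y)))" if "th \<in> Th" "x \<in> Xs" for th x
  proof (rule log_density_exists)
    show "prob_space (F th x)" "sets (F th x) = sets (F th0 x)" "prob_space (F th0 x)"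
      using kernel that th0 by auto
    have "absolutely_continuous (F a x) (F b x)" if "a \<in> Th" "b \<in> Th" for a b
    proof (cases "a = b")
      case False
      then have "KL (F b x) (F a x) < \<infinity>"
        using KL_fin[of b a x] that \<open>x \<in> Xs\<close> unfolding KLI_def by metis
      then show ?thesis by (rule KL_finite_imp_absolutely_continuous)
    qed (simp add: absolutely_continuous_def)
    then show "absolutely_continuous (F th0 x) (F th x)" "absolutely_continuous (F th x) (F th0 x)"
      using that th0 by blast+
  qed
  then have "\<forall>th. \<exists>h. \<forall>x. th \<in> Th \<longrightarrow> x \<in> Xs \<longrightarrow> h x \<in> borel_measurable (F th0 x) \<and>
      F th x = density (F th0 x) (\<lambda>y. ennreal (exp (h x y)))"
    by (intro allI choice) blast
  then show ?thesis by (rule choice[THEN exE]) blast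
qed

theorem theorem8:
  fixes Th Xs :: "real set" and F :: "real \<Rightarrow> real \<Rightarrow> real measure" and G :: "real pmf"
  assumes kernel: "\<And>th x. th \<in> Th \<Longrightarrow> x \<in> Xs \<Longrightarrow>
              prob_space (F th x) \<and> sets (F th x) = sets borel \<and> integrable (F th x) (\<lambda>y. y)"
    and G_on_X: "set_pmf G \<subseteq> Xs"
    and X_fin: "finite Xs"
    and G_pos: "\<And>x. x \<in> Xs \<Longrightarrow> pmf G x > 0"
    and KL_pos_fin: "\<And>th vth x. th \<in> Th \<Longrightarrow> vth \<in> Th \<Longrightarrow> th \<noteq> vth \<Longrightarrow> x \<in> Xs \<Longrightarrow>
              0 < KLI F th vth x \<and> KLI F th vth x < \<infinity>"
    and Th_fin: "finite Th"
    and saddle2: "\<And>th1 th2. th1 \<in> Th \<Longrightarrow> th2 \<in> Th \<Longrightarrow> \<not> revealing F Xs (th1, th2) \<Longrightarrow>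
              (\<forall>x \<in> Xs. pref F (th1, th2) x = {2}) \<Longrightarrow>
              Kinfsup F Th Xs th1 th2 = Ksupinf F Th Xs th1 th2"
    and saddle1: "\<And>th1 th2. th1 \<in> Th \<Longrightarrow> th2 \<in> Th \<Longrightarrow> \<not> revealing F Xs (th1, th2) \<Longrightarrow>
              (\<forall>x \<in> Xs. pref F (th1, th2) x = {1}) \<Longrightarrow>
              Kinfsup F Th Xs th2 th1 = Ksupinf F Th Xs th2 th1"
  shows "\<exists>pol :: (real \<times> real) list \<Rightarrow> real \<Rightarrow> nat.
           (\<forall>h x. pol h x \<in> {1, 2}) \<and>
           (\<forall>t. (\<lambda>w. arm pol w t) \<in> stream_space borel \<rightarrow>\<^sub>M count_space UNIV) \<and>
           (\<forall>th1 \<in> Th. \<forall>th2 \<in> Th. revealing F Xs (th1, th2) \<longrightarrow>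
              (\<exists>L::real. (\<lambda>t. ETinf F G (th1, th2) pol t) \<longlonglongrightarrow> L)) \<and>
           (\<forall>th1 \<in> Th. \<forall>th2 \<in> Th. \<not> revealing F Xs (th1, th2) \<longrightarrow> th1 \<noteq> th2 \<longrightarrow>
              (\<forall>x \<in> Xs. pref F (th1, th2) x = {2}) \<longrightarrow>
              limsup (\<lambda>t. ereal (ETinf F G (th1, th2) pol t / ln (real t)))
                \<le> 1 / Kinfsup F Th Xs th1 th2) \<and>
           (\<forall>th1 \<in> Th. \<forall>th2 \<in> Th. \<not> revealing F Xs (th1, th2) \<longrightarrow> th1 \<noteq> th2 \<longrightarrow>
              (\<forall>x \<in> Xs. pref F (th1, th2) x = {1}) \<longrightarrow>
              limsup (\<lambda>t. ereal (ETinf F G (th1, th2) pol t / ln (real t)))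
                \<le> 1 / Kinfsup F Th Xs th2 th1)"
proof (cases "Th = {}")
  case True
  \<comment> \<open>No configuration exists, so any measurable rule will do.\<close>
  then show ?thesis by (intro exI[of _ "\<lambda>_ _. 1"]) (simp add: arm_def)
next
  case False
  then obtain th0 where th0: "th0 \<in> Th" by blast
  obtain l where l: "\<And>th x. th \<in> Th \<Longrightarrow> x \<in> Xs \<Longrightarrow> l th x \<in> borel_measurable (F th0 x)"
    and F_eq: "\<And>th x. th \<in> Th \<Longrightarrow> x \<in> Xs \<Longrightarrow> F th x = density (F th0 x) (\<lambda>y. ennreal (exp (l th x y)))"
    using log_densities[of Th Xs F th0] kernel KL_pos_fin th0 by blast
  have Xs_ne: "Xs \<noteq> {}" using G_on_X set_pmf_not_empty[of G] by blast
  have l_borel: "l th x \<in> borel_measurable borel" if "th \<in> Th" "x \<in> Xs" for th x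
    using l[OF that] kernel[OF th0 that(2)] by (simp add: measurable_cong_sets[of "F th0 x" borel])
  interpret learner Th Xs F l
    using Th_fin False X_fin Xs_ne l_borel by unfold_locales
  \<comment> \<open>The rule is fixed before the configuration: one interpretation of
    \<open>learner\<close> serves every pair.\<close>
  have learning: "learning Th Xs F l G (th1, th2)" if "th1 \<in> Th" "th2 \<in> Th" for th1 th2
  proof (intro learning.intro learner_axioms learning_axioms.intro)
    fix th v x k assume A: "th \<in> Th" "v \<in> Th" "x \<in> Xs"
    show unit: "(\<integral>\<^sup>+y. ennreal (exp (l v x y - l th x y)) \<partial>F th x) \<le> 1"
      using nn_integral_exp_diff[OF l[OF A(1,3)] l[OF A(2,3)] F_eq[OF A(1,3)] F_eq[OF A(2,3)]]
        kernel[OF A(2,3)] by simp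
    assume ne: "th \<noteq> v" and k: "ereal k < KLI F th v x"
    have fin: "KL (F th x) (F v x) < \<infinity>" using KL_pos_fin[OF A(1,2) ne A(3)] by (simp add: KLI_def)
    note KL = KL_log_density[OF l[OF A(1,3)] l[OF A(2,3)] F_eq[OF A(1,3)] F_eq[OF A(2,3)] _ fin]
    have Q: "prob_space (F v x)" using kernel[OF A(2,3)] by simp
    show "\<forall>\<^sub>F n in sequentially.
         (\<integral>\<^sup>+y. ennreal (exp ((l v x y - l th x y) / real (n + 2))) \<partial>F th x)
           \<le> ennreal (exp (- k / real (n + 2)))"
    proof (rule eventually_mgf_le)
      show "prob_space (F th x)" using kernel[OF A(1,3)] by simp
      \<comment> \<open>The divergence is the mean of the opposite difference, hence the change of
        sign.\<close>
      have "(\<lambda>y. l v x y - l th x y) = (\<lambda>y. - (l th x y - l v x y))" by simp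
      moreover have "integrable (F th x) (\<lambda>y. - (l th x y - l v x y))"
        by (rule integrable_minus[OF KL(1)[OF Q]])
      ultimately show "integrable (F th x) (\<lambda>y. l v x y - l th x y)" by (simp only:)
      have "k < (\<integral>y. l th x y - l v x y \<partial>F th x)"
        using k KL(2)[OF Q] by (simp add: KLI_def)
      also have "\<dots> = - (\<integral>y. - (l th x y - l v x y) \<partial>F th x)"
        by (simp only: integral_minus minus_minus)
      finally show "k < - (\<integral>y. l v x y - l th x y \<partial>F th x)" by simp
    qed (rule unit)
  qed (use kernel G_on_X G_pos KL_pos_fin that in auto)
  show ?thesis
  proof (intro exI[of _ "policy choice"] conjI ballI allI impI)
    show "policy choice h x \<in> {1, 2}" for h x
      unfolding policy_def by (rule choice_arms)
    show "(\<lambda>w. arm (policy choice) w t) \<in> stream_space borel \<rightarrow>\<^sub>M count_space UNIV" for t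
      by (rule arm_choice_measurable)
  next
    fix th1 th2 assume th: "th1 \<in> Th" "th2 \<in> Th"
    show "\<exists>L. (\<lambda>t. ETinf F G (th1, th2) (policy choice) t) \<longlonglongrightarrow> L" if "revealing F Xs (th1, th2)"
      using learning.regret_revealing[OF learning[OF th] that] .
    assume nr: "\<not> revealing F Xs (th1, th2)"
    \<comment> \<open>The good arm is \<open>2\<close>, so the inferior one is
      \<open>3 - 2 = 1\<close>; the saddle point condition turns \<open>Ksupinf\<close> into
      \<open>Kinfsup\<close>.\<close>
    show "limsup (\<lambda>t. ereal (ETinf F G (th1, th2) (policy choice) t / ln (real t)))
        \<le> 1 / Kinfsup F Th Xs th1 th2" if p: "\<forall>x \<in> Xs. pref F (th1, th2) x = {2}"
      using learning.regret_nonrevealing[OF learning[OF th], of 2] p saddle2[OF th nr p]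
      by (simp add: par_def)
    show "limsup (\<lambda>t. ereal (ETinf F G (th1, th2) (policy choice) t / ln (real t)))
        \<le> 1 / Kinfsup F Th Xs th2 th1" if p: "\<forall>x \<in> Xs. pref F (th1, th2) x = {1}"
      using learning.regret_nonrevealing[OF learning[OF th], of 1] p saddle1[OF th nr p]
      by (simp add: par_def)
  qed
qed

end
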